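(* Let $H_1,\dots,H_m\in C^2(T^*M\times\mathbb{R}^m,\mathbb{R})$ satisfy assumptions (H1)–(H3) and (H* ) listed in the context, let $\varphi\in C(M,\mathbb{R}^m)$, and let $\mathbf{u}\in C(M\times[0,\infty),\mathbb{R}^m)$ be the unique viscosity solution of the Cauchy problem $$\partial_t u_i+H_i(x,\partial_x u_i,\mathbf{u})=0\ \text{ on } M\times[0,\infty),\qquad \mathbf{u}(x,0)=\varphi(x)\ \text{ for } x\in M,\qquad 1\le i\le m.$$ Then $\mathbf{u}$ is locally Lipschitz continuous with respect to $t$ and $x$ on $M\times(0,\infty)$. Moreover, there is a continuous function $\kappa_\varphi:(0,\infty)\to(0,\infty)$ such that for all $x,y\in M$ and $t\in(0,\infty)$, $$\|\mathbf{u}(x,t)-\mathbf{u}(y,t)\|\le\kappa_\varphi(t)\,|x-y|,$$ and there exist constants $t_\Theta,\kappa_0>0$ such that $\kappa_\varphi(t)\le\kappa_0\,t^{-1/r}$ for all $t\in(0,t_\Theta]$.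
   Context: $n,m>1$ are fixed integers, $M=\mathbb{T}^n$ is the flat $n$-torus, $|x-y|$ is the distance on $M$ induced by the flat metric, $T_xM$ and $T_x^*M$ are identified with $\mathbb{R}^n$ with Euclidean norm $|\cdot|$; $\|v\|=\max_{1\le i\le m}|v_i|$ for $v\in\mathbb{R}^m$. Assumptions, for each $1\le i\le m$: (H1) $H_i(x,p,\mathbf{u})$ is strictly convex in $p$. (H2) $H_i$ is superlinear in $p$: for every $(x,\mathbf{u})$, $H_i(x,p,\mathbf{u})/|p|\to\infty$ as $|p|\to\infty$. (H3) $|H_i(x,p,\mathbf{u})-H_i(x,p,\mathbf{v})|\le\Theta\|\mathbf{u}-\mathbf{v}\|$ for all $x,p,\mathbf{u},\mathbf{v}$, for some $\Theta>0$ (the maximal Lipschitz constant of the $H_i$ in $\mathbf{u}$). (H* ) $H_i(x,p,\mathbf{u})=h_i(x,p)+P_i(x,\mathbf{u})$, and there exist $r,A\in(1,\infty)$ (common to all $i$) such that for all $(x,p)$: $A^{-1}|p|^r-A\le h_i(x,p)\le A|p|^r$ and $|\partial_x h_i(x,p)|\le A(|p|^r+1)$. The number $r$ in the claim is the exponent in (H* ). Viscosity solution: a continuous $\mathbf{u}:M\times[0,\infty)\to\mathbb{R}^m$ is a viscosity subsolution of the Cauchy problem if for each $1\le i\le m$: $u_i(\cdot,0)\le\varphi_i$ on $M$, and whenever $\phi$ is a real-valued $C^1$ function on a neighborhood of $(x,t)$, $t>0$, such that $u_i-\phi$ attains a local maximum at $(x,t)$, one has $\partial_t\phi(x,t)+H_i(x,\partial_x\phi(x,t),\mathbf{u}(x,t))\le0$.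 It is a viscosity supersolution if for each $i$: $u_i(\cdot,0)\ge\varphi_i$ on $M$, and whenever $\phi$ is $C^1$ near $(x,t)$, $t>0$, and $u_i-\phi$ attains a local minimum at $(x,t)$, one has $\partial_t\phi(x,t)+H_i(x,\partial_x\phi(x,t),\mathbf{u}(x,t))\ge0$. It is a viscosity solution if it is both. Under (H1)–(H3) a viscosity solution in $C(M\times[0,\infty),\mathbb{R}^m)$ exists and is unique. *)

theory Defs
  imports "HOL-Analysis.Analysis"
begin

text \<open>
  The flat torus is the quotient of \<^typ>\<open>real^'n\<close> by the integer lattice.  A function on the torus
  is represented by its lift, a lattice-periodic function on \<^typ>\<open>real^'n\<close>.
\<close>

definition int_lattice :: "(real^'n) set" where
  "int_lattice = {k. \<forall>j. k $ j \<in> \<int>}"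

definition periodic :: "(real^'n \<Rightarrow> 'b) \<Rightarrow> bool" where
  "periodic f \<longleftrightarrow> (\<forall>x. \<forall>k\<in>int_lattice. f (x + k) = f x)"

text \<open>The distance between the classes of \<open>x\<close> and \<open>y\<close> in the quotient metric.\<close>

definition torus_dist :: "real^'n \<Rightarrow> real^'n \<Rightarrow> real" where
  "torus_dist x y = (INF k\<in>int_lattice. dist x (y + k))"

text \<open>Continuous differentiability; meant for open \<open>S\<close>.\<close>

definition C1_on :: "'a::real_normed_vector set \<Rightarrow> ('a \<Rightarrow> 'b::real_normed_vector) \<Rightarrow> bool" where
  "C1_on S f \<longleftrightarrow> (\<exists>f' :: 'a \<Rightarrow> 'a \<Rightarrow>\<^sub>L 'b.
     (\<forall>x\<in>S. (f has_derivative blinfun_apply (f' x)) (at x)) \<and> continuous_on S f')"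

definition C2_on :: "'a::real_normed_vector set \<Rightarrow> ('a \<Rightarrow> 'b::real_normed_vector) \<Rightarrow> bool" where
  "C2_on S f \<longleftrightarrow> (\<exists>f' :: 'a \<Rightarrow> 'a \<Rightarrow>\<^sub>L 'b.
     (\<forall>x\<in>S. (f has_derivative blinfun_apply (f' x)) (at x)) \<and> C1_on S f')"

text \<open>
  A map from torus \<open>\<times> [0,\<infinity>)\<close> to \<open>\<real>\<^sup>m\<close> is represented by \<open>u :: (real^'n) \<times> real \<Rightarrow> real^'m\<close>, of which
  only the values at times \<open>t \<ge> 0\<close> matter.
\<close>

definition continuous_on_cylinder :: "((real^'n) \<times> real \<Rightarrow> real^'m) \<Rightarrow> bool" where
  "continuous_on_cylinder u \<longleftrightarrow>
     continuous_on (UNIV \<times> {0..}) u \<and> (\<forall>t\<ge>0. periodic (\<lambda>x. u (x, t)))"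

text \<open>
  Test functions are defined on an open neighbourhood \<open>S\<close> of the touching point and need not be
  periodic: a small ball in the torus is isometric to one in \<^typ>\<open>real^'n\<close>.
  The vector \<open>q\<close> is the spatial gradient and \<open>\<tau>\<close> the time derivative of the test function at the
  touching point; both exist and are unique because the test function is \<open>C\<^sup>1\<close>.  As \<open>t > 0\<close>, the
  local extremum only involves positive times.
\<close>

definition viscosity_subsolution ::
  "('m \<Rightarrow> real^'n \<Rightarrow> real^'n \<Rightarrow> real^'m \<Rightarrow> real) \<Rightarrow> (real^'n \<Rightarrow> real^'m)
     \<Rightarrow> ((real^'n) \<times> real \<Rightarrow> real^'m) \<Rightarrow> bool" where
  "viscosity_subsolution H \<phi> u \<longleftrightarrow> continuous_on_cylinder u \<and>
     (\<forall>i. (\<forall>x. u (x, 0) $ i \<le> \<phi> x $ i) \<and>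
       (\<forall>x t S \<psi> q \<tau>. t > 0 \<longrightarrow> open S \<longrightarrow> (x, t) \<in> S \<longrightarrow> C1_on S \<psi>
          \<longrightarrow> (\<forall>\<^sub>F z in nhds (x, t). u z $ i - \<psi> z \<le> u (x, t) $ i - \<psi> (x, t))
          \<longrightarrow> GDERIV (\<lambda>y. \<psi> (y, t)) x :> q
          \<longrightarrow> ((\<lambda>s. \<psi> (x, s)) has_real_derivative \<tau>) (at t)
          \<longrightarrow> \<tau> + H i x q (u (x, t)) \<le> 0))"

definition viscosity_supersolution ::
  "('m \<Rightarrow> real^'n \<Rightarrow> real^'n \<Rightarrow> real^'m \<Rightarrow> real) \<Rightarrow> (real^'n \<Rightarrow> real^'m)
     \<Rightarrow> ((real^'n) \<times> real \<Rightarrow> real^'m) \<Rightarrow> bool" where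
  "viscosity_supersolution H \<phi> u \<longleftrightarrow> continuous_on_cylinder u \<and>
     (\<forall>i. (\<forall>x. u (x, 0) $ i \<ge> \<phi> x $ i) \<and>
       (\<forall>x t S \<psi> q \<tau>. t > 0 \<longrightarrow> open S \<longrightarrow> (x, t) \<in> S \<longrightarrow> C1_on S \<psi>
          \<longrightarrow> (\<forall>\<^sub>F z in nhds (x, t). u z $ i - \<psi> z \<ge> u (x, t) $ i - \<psi> (x, t))
          \<longrightarrow> GDERIV (\<lambda>y. \<psi> (y, t)) x :> q
          \<longrightarrow> ((\<lambda>s. \<psi> (x, s)) has_real_derivative \<tau>) (at t)
          \<longrightarrow> \<tau> + H i x q (u (x, t)) \<ge> 0))"

definition viscosity_solution ::
  "('m \<Rightarrow> real^'n \<Rightarrow> real^'n \<Rightarrow> real^'m \<Rightarrow> real) \<Rightarrow> (real^'n \<Rightarrow> real^'m)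
     \<Rightarrow> ((real^'n) \<times> real \<Rightarrow> real^'m) \<Rightarrow> bool" where
  "viscosity_solution H \<phi> u \<longleftrightarrow> viscosity_subsolution H \<phi> u \<and> viscosity_supersolution H \<phi> u"

definition strictly_convex :: "('a::real_vector \<Rightarrow> real) \<Rightarrow> bool" where
  "strictly_convex f \<longleftrightarrow> (\<forall>p q s. p \<noteq> q \<longrightarrow> 0 < s \<longrightarrow> s < 1 \<longrightarrow>
     f ((1 - s) *\<^sub>R p + s *\<^sub>R q) < (1 - s) * f p + s * f q)"

text \<open>
  Local Lipschitz continuity jointly in all variables.  The library's \<open>local_lipschitz\<close> is about
  families that are Lipschitz in only one of two variables.
\<close>

definition locally_lipschitz_on :: "'a::metric_space set \<Rightarrow> ('a \<Rightarrow> 'b::metric_space) \<Rightarrow> bool" where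
  "locally_lipschitz_on S f \<longleftrightarrow> (\<forall>z\<in>S. \<exists>\<epsilon>>0. \<exists>L. L-lipschitz_on (ball z \<epsilon> \<inter> S) f)"

text \<open>The maximum norm on \<^typ>\<open>real^'m\<close> is the library's \<^const>\<open>infnorm\<close>.\<close>

lemma infnorm_eq_Max: "infnorm (v :: real^'m) = Max (range (\<lambda>i. \<bar>v $ i\<bar>))"
  by (simp add: infnorm_cart full_SetCompr_eq cSup_eq_Max)

end

(* A solution is compared with itself at two points: at a maximum of
     u_i(y,t) - u_i(x,t) - |y - x| (kappa(t) + K(t) u_i(x,t)),   kappa = C t^(-1/r), K = k t^(-1/r),
   the weight in front of u_i(x,t) exceeds 1 by a multiple of |y - x|.  By convexity and the growth
   of h_i this dilation produces a positive term of order K |y - x| |p|^r with |p| comparable to kappa.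
   For C >> k >> 1 it dominates everything else: the x-dependence of h_i, the coupling through P_i
   (Lipschitz in u, and all differences |u_j(y,t) - u_j(x,t)| are controlled by the maximum), and the
   derivative of kappa, where the exponent -1/r makes both sides scale like |y - x| t^(-1/r - 1).
   Since kappa blows up at t = 0, no regularity of the initial data is needed.
   Lipschitz continuity in time then follows because the equation bounds the time derivative. *)

theory Submission
  imports Defs
begin

section \<open>Viscosity tests by gradients\<close>

text \<open>The obstacle is that \<open>u\<close> need not be differentiable: the equations at the
  maximum are reachable only through test functions of one space-time point each. So time is doubled
  too, with a penalty \<open>n * (t - s)\<^sup>2\<close>. Solving the compared expression for
  \<open>u (x, s) $ i\<close> means dividing by \<open>a = 1 + K t * norm (y - x)\<close>. Hence the
  two equations carry the momenta \<open>q\<close> and \<open>q / a\<close>; multiplying the second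
  by \<open>a\<close> cancels the penalty derivatives exactly and produces
  \<open>a * h (q / a)\<close>, the quantity to which convexity applies. The coupling is controlled
  by the maximum only up to the maximal value itself, an error that is not proportional to |y - x|.
  The weight \<open>exp (- N * (t - T))\<close> with \<open>N > \<Theta>\<close> absorbs it: the gap
  \<theta> then grows at rate \<open>N\<close>, which pays for \<Theta> \<theta>. On an interval
  reaching one unit beyond \<open>T\<close> the same weight keeps the maximum away from the final
  time. Near t = 0 a positive value forces |y - x| to be at most of order 1/kappa, and uniform
  continuity of \<open>u\<close> makes the expression small there.\<close>

lemma C1_on_gderiv:
  assumes "\<And>z. z \<in> S \<Longrightarrow> GDERIV \<psi> z :> g z" and "continuous_on S g"
  shows "C1_on S \<psi>"
  unfolding C1_on_def
proof (intro exI conjI ballI)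
  show "(\<psi> has_derivative blinfun_apply (blinfun_inner_left (g z))) (at z)" if "z \<in> S" for z
    using assms(1)[OF that] by (simp add: gderiv_def inner_commute)
  show "continuous_on S (\<lambda>z. blinfun_inner_left (g z))"
    using assms(2) by (rule bounded_linear.continuous_on[OF bounded_linear_blinfun_inner_left])
qed

lemma GDERIV_slices:
  fixes \<psi> :: "'a::real_inner \<times> real \<Rightarrow> real"
  assumes "GDERIV \<psi> (x, t) :> (q, \<tau>)"
  shows "GDERIV (\<lambda>y. \<psi> (y, t)) x :> q"
    and "((\<lambda>s. \<psi> (x, s)) has_real_derivative \<tau>) (at t)"
proof -
  have D: "(\<psi> has_derivative (\<lambda>h. h \<bullet> (q, \<tau>))) (at (x, t))"
    using assms by (simp add: gderiv_def)
  have "((\<lambda>y. (y, t)) has_derivative (\<lambda>h. (h, 0))) (at x)"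
    by (auto intro!: derivative_eq_intros)
  from has_derivative_compose[OF this D] show "GDERIV (\<lambda>y. \<psi> (y, t)) x :> q"
    by (simp add: gderiv_def)
  have "((\<lambda>s. (x, s)) has_derivative (\<lambda>h. (0, h))) (at t)"
    by (auto intro!: derivative_eq_intros)
  from has_derivative_compose[OF this D]
  show "((\<lambda>s. \<psi> (x, s)) has_real_derivative \<tau>) (at t)"
    by (simp add: has_field_derivative_def mult_commute_abs)
qed

text \<open>One gradient on space-time supplies both slice derivatives that the definition asks for,
  so a test function is differentiated once, by the product and chain rules.\<close>

lemma subsolution_test:
  assumes "viscosity_subsolution H \<phi> u" and "t > 0" "open S" "(x, t) \<in> S"
    and "\<And>z. z \<in> S \<Longrightarrow> GDERIV \<psi> z :> g z" "continuous_on S g" "g (x, t) = (q, \<tau>)"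
    and "\<forall>\<^sub>F z in nhds (x, t). u z $ i - \<psi> z \<le> u (x, t) $ i - \<psi> (x, t)"
  shows "\<tau> + H i x q (u (x, t)) \<le> 0"
proof -
  have "GDERIV \<psi> (x, t) :> (q, \<tau>)" using assms(4,5,7) by metis
  note * = GDERIV_slices[OF this] C1_on_gderiv[OF assms(5,6)]
  with assms show ?thesis unfolding viscosity_subsolution_def by blast
qed

lemma supersolution_test:
  assumes "viscosity_supersolution H \<phi> u" and "t > 0" "open S" "(x, t) \<in> S"
    and "\<And>z. z \<in> S \<Longrightarrow> GDERIV \<psi> z :> g z" "continuous_on S g" "g (x, t) = (q, \<tau>)"
    and "\<forall>\<^sub>F z in nhds (x, t). u z $ i - \<psi> z \<ge> u (x, t) $ i - \<psi> (x, t)"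
  shows "\<tau> + H i x q (u (x, t)) \<ge> 0"
proof -
  have "GDERIV \<psi> (x, t) :> (q, \<tau>)" using assms(4,5,7) by metis
  note * = GDERIV_slices[OF this] C1_on_gderiv[OF assms(5,6)]
  with assms show ?thesis unfolding viscosity_supersolution_def by blast
qed

lemma GDERIV_comp_snd:
  assumes "(f has_real_derivative d) (at (snd z))"
  shows "GDERIV (\<lambda>z. f (snd z)) z :> (0, d)"
proof -
  have "(f has_derivative (\<lambda>h. h * d)) (at (snd z))"
    using assms by (simp add: has_field_derivative_def mult_commute_abs)
  from has_derivative_compose[OF has_derivative_snd[OF has_derivative_ident] this]
  show ?thesis by (simp add: gderiv_def inner_prod_def)
qed

lemma GDERIV_comp_fst:
  assumes "GDERIV f (fst z) :> d"
  shows "GDERIV (\<lambda>z. f (fst z)) z :> (d, 0)"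
proof -
  from has_derivative_compose[OF has_derivative_fst[OF has_derivative_ident] assms[unfolded gderiv_def]]
  show ?thesis by (simp add: gderiv_def inner_prod_def)
qed

lemma GDERIV_dist:
  assumes "x \<noteq> a"
  shows "GDERIV (\<lambda>x. norm (x - a)) x :> sgn (x - a)"
proof -
  have "((\<lambda>x. x - a) has_derivative (\<lambda>h. h)) (at x)"
    by (auto intro!: derivative_eq_intros)
  moreover have "(norm has_derivative (\<lambda>h. h \<bullet> sgn (x - a))) (at (x - a))"
    using GDERIV_norm[of "x - a"] assms by (simp add: gderiv_def)
  ultimately show ?thesis
    using has_derivative_compose by (fastforce simp: gderiv_def)
qed

lemma GDERIV_dist_sq: "GDERIV (\<lambda>x. (norm (x - a))\<^sup>2) x :> 2 *\<^sub>R (x - a)"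
  unfolding power2_norm_eq_inner gderiv_def
  by (rule derivative_eq_intros refl)+ (auto simp: inner_commute)

lemma GDERIV_divide:
  assumes "GDERIV f x :> df" "GDERIV g x :> dg" "g x \<noteq> 0"
  shows "GDERIV (\<lambda>x. f x / g x) x :> (1 / g x) *\<^sub>R (df - (f x / g x) *\<^sub>R dg)"
  unfolding divide_inverse
  by (rule GDERIV_subst[OF GDERIV_mult[OF assms(1) GDERIV_inverse[OF assms(2,3)]]])
     (auto simp: algebra_simps power2_eq_square)

lemma H_jointly_continuous:
  assumes "C2_on UNIV (\<lambda>(x, p, w). F x p w)"
  shows "continuous_on UNIV (\<lambda>(x, p, w). F x p w)"
  using assms unfolding C2_on_def
  by (metis has_derivative_continuous continuous_at_imp_continuous_on)

section \<open>Doubling the time variable\<close>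

text \<open>The weights depend on \<open>t\<close> alone, so their derivatives enter only through
  the subsolution test at \<open>(y1, t1)\<close>; in time the supersolution test at
  \<open>(x1, s1)\<close> sees just the penalty. Its contribution
  \<open>2 * n * (t1 - s1) / a\<close>, multiplied by \<open>a\<close>, cancels against that of the
  subsolution, and the conclusion is free of \<open>n\<close>.\<close>

lemma doubling_at_maximum:
  fixes u :: "(real^'n) \<times> real \<Rightarrow> real^'m::finite" and i :: 'm
    and \<kappa> K \<theta> :: "real \<Rightarrow> real" and x0 y0 :: "real^'n" and t0 n :: real
  defines "G \<equiv> \<lambda>y t x s. u (y, t) $ i - u (x, s) $ i - norm (y - x) * (\<kappa> t + K t * u (x, s) $ i)
     - \<theta> t - n * (t - s)\<^sup>2 - (norm (y - y0))\<^sup>2 - (norm (x - x0))\<^sup>2 - (t - t0)\<^sup>2"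
  assumes sol: "viscosity_solution H \<phi> u"
    and \<kappa>: "\<And>t. t > 0 \<Longrightarrow> (\<kappa> has_real_derivative \<kappa>' t) (at t)" "continuous_on {0<..} \<kappa>'"
    and K: "\<And>t. t > 0 \<Longrightarrow> (K has_real_derivative K' t) (at t)" "continuous_on {0<..} K'"
    and \<theta>: "\<And>t. t > 0 \<Longrightarrow> (\<theta> has_real_derivative \<theta>' t) (at t)" "continuous_on {0<..} \<theta>'"
    and K_nonneg: "\<And>t. t > 0 \<Longrightarrow> K t \<ge> 0"
    and pos: "t1 > 0" "s1 > 0" and ne: "x1 \<noteq> y1"
    and max_y: "\<forall>\<^sub>F z in nhds (y1, t1). G (fst z) (snd z) x1 s1 \<le> G y1 t1 x1 s1"
    and max_x: "\<forall>\<^sub>F z in nhds (x1, s1). G y1 t1 (fst z) (snd z) \<le> G y1 t1 x1 s1"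
  shows "norm (y1 - x1) * (\<kappa>' t1 + K' t1 * u (x1, s1) $ i) + \<theta>' t1 + 2 * (t1 - t0)
     + H i y1 ((\<kappa> t1 + K t1 * u (x1, s1) $ i) *\<^sub>R sgn (y1 - x1) + 2 *\<^sub>R (y1 - y0)) (u (y1, t1))
     - (1 + K t1 * norm (y1 - x1)) * H i x1 ((1 / (1 + K t1 * norm (y1 - x1))) *\<^sub>R
        ((\<kappa> t1 + K t1 * u (x1, s1) $ i) *\<^sub>R sgn (y1 - x1) - 2 *\<^sub>R (x1 - x0))) (u (x1, s1)) \<le> 0"
proof -
  define c where "c = u (x1, s1) $ i"
  define a where "a = 1 + K t1 * norm (y1 - x1)"
  define q where "q = (\<kappa> t1 + K t1 * c) *\<^sub>R sgn (y1 - x1)"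
  have a_pos: "a > 0" unfolding a_def using K_nonneg[OF pos(1)] by (simp add: add_pos_nonneg)
  have cont: "continuous_on {0<..} \<kappa>" "continuous_on {0<..} K" "continuous_on {0<..} \<theta>"
    using \<kappa>(1) K(1) \<theta>(1) by (meson DERIV_isCont continuous_at_imp_continuous_on greaterThan_iff)+
  have sub: "viscosity_subsolution H \<phi> u" and sup: "viscosity_supersolution H \<phi> u"
    using sol by (auto simp: viscosity_solution_def)

  define \<psi>1 where "\<psi>1 z = norm (fst z - x1) * (\<kappa> (snd z) + K (snd z) * c)
    + (\<theta> (snd z) + n * (snd z - s1)\<^sup>2 + (snd z - t0)\<^sup>2) + (norm (fst z - y0))\<^sup>2" for z :: "(real^'n) \<times> real"
  define g1 where "g1 z = ((\<kappa> (snd z) + K (snd z) * c) *\<^sub>R sgn (fst z - x1) + 2 *\<^sub>R (fst z - y0),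
     norm (fst z - x1) * (\<kappa>' (snd z) + K' (snd z) * c) + \<theta>' (snd z) + 2 * n * (snd z - s1)
       + 2 * (snd z - t0))" for z :: "(real^'n) \<times> real"
  have "(norm (y1 - x1) * (\<kappa>' t1 + K' t1 * c) + \<theta>' t1 + 2 * n * (t1 - s1) + 2 * (t1 - t0))
     + H i y1 (q + 2 *\<^sub>R (y1 - y0)) (u (y1, t1)) \<le> 0"
  proof (rule subsolution_test[OF sub pos(1), where S = "(- {x1}) \<times> {0<..}" and \<psi> = \<psi>1 and g = g1])
    show "open ((- {x1}) \<times> {0::real<..})" by (intro open_Times) auto
    show "(y1, t1) \<in> (- {x1}) \<times> {0<..}" using ne pos by auto
    show "GDERIV \<psi>1 z :> g1 z" if "z \<in> (- {x1}) \<times> {0<..}" for z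
    proof -
      have z: "fst z \<noteq> x1" "snd z > 0" using that by auto
      have 1: "((\<lambda>t. \<kappa> t + K t * c) has_real_derivative (\<kappa>' (snd z) + K' (snd z) * c)) (at (snd z))"
        using \<kappa>(1)[OF z(2)] K(1)[OF z(2)] by (auto intro!: derivative_eq_intros)
      have 2: "((\<lambda>t. \<theta> t + n * (t - s1)\<^sup>2 + (t - t0)\<^sup>2) has_real_derivative
          (\<theta>' (snd z) + 2 * n * (snd z - s1) + 2 * (snd z - t0))) (at (snd z))"
        using \<theta>(1)[OF z(2)] by (auto intro!: derivative_eq_intros)
      show ?thesis unfolding \<psi>1_def
        apply (rule GDERIV_subst)
         apply (rule GDERIV_add[OF GDERIV_add[OF GDERIV_mult] ])
            apply (rule GDERIV_comp_fst[OF GDERIV_dist[OF z(1)]])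
           apply (rule GDERIV_comp_snd[OF 1])
          apply (rule GDERIV_comp_snd[OF 2])
         apply (rule GDERIV_comp_fst[OF GDERIV_dist_sq])
        apply (simp add: g1_def)
        done
    qed
    show "continuous_on ((- {x1}) \<times> {0<..}) g1"
      unfolding g1_def sgn_div_norm
      by (auto intro!: continuous_intros continuous_on_compose2[OF cont(1)] continuous_on_compose2[OF cont(2)]
          continuous_on_compose2[OF \<kappa>(2)] continuous_on_compose2[OF K(2)] continuous_on_compose2[OF \<theta>(2)])
    show "g1 (y1, t1) = (q + 2 *\<^sub>R (y1 - y0),
      norm (y1 - x1) * (\<kappa>' t1 + K' t1 * c) + \<theta>' t1 + 2 * n * (t1 - s1) + 2 * (t1 - t0))"
      by (simp add: g1_def q_def)
    show "\<forall>\<^sub>F z in nhds (y1, t1). u z $ i - \<psi>1 z \<le> u (y1, t1) $ i - \<psi>1 (y1, t1)"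
      using max_y by eventually_elim (simp add: G_def \<psi>1_def c_def)
  qed
  moreover
  \<comment> \<open>\<open>W\<close> collects what does not involve \<open>(x, s)\<close>.
    Maximality then says that \<open>u (x, s) $ i\<close> times its coefficient
    \<open>1 + K t1 * norm (x - y1)\<close> is at least the numerator of \<open>\<psi>2\<close>,
    with equality at \<open>(x1, s1)\<close>.\<close>
  define W where "W = u (y1, t1) $ i - \<theta> t1 - (norm (y1 - y0))\<^sup>2 - (t1 - t0)\<^sup>2 - G y1 t1 x1 s1"
  define \<psi>2 where "\<psi>2 z = (W + (- \<kappa> t1) * norm (fst z - y1) + (- (norm (fst z - x0))\<^sup>2) + (- n) * (t1 - snd z)\<^sup>2)
    / (1 + K t1 * norm (fst z - y1))" for z :: "(real^'n) \<times> real"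
  define g2 where "g2 z = (1 / (1 + K t1 * norm (fst z - y1))) *\<^sub>R
     (((- \<kappa> t1) *\<^sub>R sgn (fst z - y1) - 2 *\<^sub>R (fst z - x0), 2 * n * (t1 - snd z))
       - \<psi>2 z *\<^sub>R (K t1 *\<^sub>R sgn (fst z - y1), 0))" for z :: "(real^'n) \<times> real"
  have den: "1 + K t1 * norm (x - y1) > 0" for x
    using K_nonneg[OF pos(1)] by (simp add: add_pos_nonneg)
  have \<psi>2_at: "\<psi>2 (x1, s1) = c"
    using den[of x1] by (simp add: \<psi>2_def W_def G_def c_def field_simps norm_minus_commute)
  have "2 * n * (t1 - s1) / a + H i x1 ((1 / a) *\<^sub>R (q - 2 *\<^sub>R (x1 - x0))) (u (x1, s1)) \<ge> 0"
  proof (rule supersolution_test[OF sup pos(2), where S = "(- {y1}) \<times> {0<..}" and \<psi> = \<psi>2 and g = g2])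
    show "open ((- {y1}) \<times> {0::real<..})" by (intro open_Times) auto
    show "(x1, s1) \<in> (- {y1}) \<times> {0<..}" using ne pos by auto
    show "GDERIV \<psi>2 z :> g2 z" if "z \<in> (- {y1}) \<times> {0<..}" for z
    proof -
      have z: "fst z \<noteq> y1" "snd z > 0" using that by auto
      have 1: "((\<lambda>s. (- n) * (t1 - s)\<^sup>2) has_real_derivative (2 * n * (t1 - snd z))) (at (snd z))"
        by (auto intro!: derivative_eq_intros simp: algebra_simps)
      have N: "GDERIV (\<lambda>z. W + (- \<kappa> t1) * norm (fst z - y1) + (- (norm (fst z - x0))\<^sup>2) + (- n) * (t1 - snd z)\<^sup>2) z
        :> ((- \<kappa> t1) *\<^sub>R sgn (fst z - y1) - 2 *\<^sub>R (fst z - x0), 2 * n * (t1 - snd z))"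
        apply (rule GDERIV_subst)
         apply (rule GDERIV_add[OF GDERIV_add[OF GDERIV_add]])
            apply (rule GDERIV_const)
           apply (rule GDERIV_mult[OF GDERIV_const GDERIV_comp_fst[OF GDERIV_dist[OF z(1)]]])
          apply (rule GDERIV_minus[OF GDERIV_comp_fst[OF GDERIV_dist_sq]])
         apply (rule GDERIV_comp_snd[OF 1])
        apply simp
        done
      have D: "GDERIV (\<lambda>z. 1 + K t1 * norm (fst z - y1)) z :> (K t1 *\<^sub>R sgn (fst z - y1), 0)"
        apply (rule GDERIV_subst)
         apply (rule GDERIV_add[OF GDERIV_const GDERIV_mult[OF GDERIV_const GDERIV_comp_fst[OF GDERIV_dist[OF z(1)]]]])
        apply simp
        done
      show ?thesis
        using GDERIV_divide[OF N D] den[of "fst z"] unfolding g2_def \<psi>2_def by auto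
    qed
    have d0: "1 + K t1 * norm (x - y1) \<noteq> 0" for x using den[of x] by simp
    show "continuous_on ((- {y1}) \<times> {0<..}) g2"
      unfolding g2_def \<psi>2_def sgn_div_norm
      by (auto intro!: continuous_intros simp: d0)
    have "sgn (x1 - y1) = - sgn (y1 - x1)" by (metis minus_diff_eq sgn_minus)
    then show "g2 (x1, s1) = ((1 / a) *\<^sub>R (q - 2 *\<^sub>R (x1 - x0)), 2 * n * (t1 - s1) / a)"
      by (simp add: g2_def \<psi>2_at a_def q_def norm_minus_commute algebra_simps diff_divide_distrib)
    show "\<forall>\<^sub>F z in nhds (x1, s1). u z $ i - \<psi>2 z \<ge> u (x1, s1) $ i - \<psi>2 (x1, s1)"
      using max_x
    proof eventually_elim
      case (elim z)
      then have "W + (- \<kappa> t1) * norm (fst z - y1) + (- (norm (fst z - x0))\<^sup>2) + (- n) * (t1 - snd z)\<^sup>2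
          \<le> u z $ i * (1 + K t1 * norm (fst z - y1))"
        by (simp add: W_def G_def norm_minus_commute[of y1] algebra_simps)
      then have "\<psi>2 z \<le> u z $ i" unfolding \<psi>2_def using den[of "fst z"] by (simp add: divide_le_eq)
      then show ?case by (simp add: \<psi>2_at c_def)
    qed
  qed
  then have "a * (2 * n * (t1 - s1) / a + H i x1 ((1 / a) *\<^sub>R (q - 2 *\<^sub>R (x1 - x0))) (u (x1, s1))) \<ge> 0"
    using a_pos by simp
  then have "2 * n * (t1 - s1) + a * H i x1 ((1 / a) *\<^sub>R (q - 2 *\<^sub>R (x1 - x0))) (u (x1, s1)) \<ge> 0"
    using a_pos by (simp add: distrib_left)
  ultimately show ?thesis
    unfolding c_def[symmetric] a_def[symmetric] q_def[symmetric] by linarith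
qed

text \<open>This is the limit of \<open>doubling_at_maximum\<close> for an infinite penalty. The
  touching is given for equal times and may fail to be strict; the quadratic terms make it strict,
  so the penalised maxima converge to the touching point, and continuity of \<open>H\<close> carries
  the inequality over.\<close>

proposition doubling_inequality:
  fixes u :: "(real^'n) \<times> real \<Rightarrow> real^'m::finite" and i :: 'm
    and \<kappa> K \<theta> :: "real \<Rightarrow> real" and x0 y0 :: "real^'n" and t0 :: real
  defines "c \<equiv> u (x0, t0) $ i"
  defines "a \<equiv> 1 + K t0 * norm (y0 - x0)"
  defines "q \<equiv> (\<kappa> t0 + K t0 * c) *\<^sub>R sgn (y0 - x0)"
  assumes sol: "viscosity_solution H \<phi> u"
    and H_cont: "continuous_on UNIV (\<lambda>(x, p, w). H i x p w)"
    and \<kappa>: "\<And>t. t > 0 \<Longrightarrow> (\<kappa> has_real_derivative \<kappa>' t) (at t)" "continuous_on {0<..} \<kappa>'"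
    and K: "\<And>t. t > 0 \<Longrightarrow> (K has_real_derivative K' t) (at t)" "continuous_on {0<..} K'"
    and \<theta>: "\<And>t. t > 0 \<Longrightarrow> (\<theta> has_real_derivative \<theta>' t) (at t)" "continuous_on {0<..} \<theta>'"
    and K_nonneg: "\<And>t. t > 0 \<Longrightarrow> K t \<ge> 0"
    and "t0 > 0" and ne: "x0 \<noteq> y0" and "\<rho>0 > 0"
    and le: "\<And>x y t. \<lbrakk>t > 0; \<bar>t - t0\<bar> \<le> \<rho>0\<rbrakk> \<Longrightarrow>
       u (y, t) $ i \<le> u (x, t) $ i + norm (y - x) * (\<kappa> t + K t * u (x, t) $ i) + \<theta> t"
    and eq: "u (y0, t0) $ i = c + norm (y0 - x0) * (\<kappa> t0 + K t0 * c) + \<theta> t0"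
  shows "norm (y0 - x0) * (\<kappa>' t0 + K' t0 * c) + \<theta>' t0
     + H i y0 q (u (y0, t0)) - a * H i x0 ((1 / a) *\<^sub>R q) (u (x0, t0)) \<le> 0"
proof -
  \<comment> \<open>Keeps the times positive and inside the window where \<open>le\<close> holds,
    and the two spatial balls disjoint, so that the norm is only differentiated away from
    zero.\<close>
  define \<rho> where "\<rho> = min \<rho>0 (min (t0 / 2) (norm (y0 - x0) / 4))"
  have \<rho>: "\<rho> > 0" "\<rho> \<le> \<rho>0" "\<rho> < t0" "2 * \<rho> < norm (y0 - x0)"
    using \<open>t0 > 0\<close> ne \<open>\<rho>0 > 0\<close> by (auto simp: \<rho>_def min_def)
  have cu: "continuous_on (UNIV \<times> {0..}) u"
    using sol by (auto simp: viscosity_solution_def viscosity_subsolution_def continuous_on_cylinder_def)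
  have cont: "continuous_on {0<..} \<kappa>" "continuous_on {0<..} K" "continuous_on {0<..} \<theta>"
    using \<kappa>(1) K(1) \<theta>(1) by (meson DERIV_isCont continuous_at_imp_continuous_on greaterThan_iff)+
  define D where "D = (cball y0 \<rho> \<times> cball t0 \<rho>) \<times> (cball x0 \<rho> \<times> cball t0 \<rho>)"
  define F where "F = (\<lambda>((y, t), (x, s)). u (y, t) $ i - u (x, s) $ i
     - norm (y - x) * (\<kappa> t + K t * u (x, s) $ i)
     - \<theta> t - (norm (y - y0))\<^sup>2 - (norm (x - x0))\<^sup>2 - (t - t0)\<^sup>2)"
  define G where "G = (\<lambda>n y t x s. u (y, t) $ i - u (x, s) $ i - norm (y - x) * (\<kappa> t + K t * u (x, s) $ i)
     - \<theta> t - n * (t - s)\<^sup>2 - (norm (y - y0))\<^sup>2 - (norm (x - x0))\<^sup>2 - (t - t0)\<^sup>2)"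
  have G_F: "G n y t x s = F ((y, t), (x, s)) - n * (t - s)\<^sup>2" for n y t x s
    by (simp add: G_def F_def)
  have D_compact: "compact D" unfolding D_def by (intro compact_Times compact_cball)
  have D_pos: "snd (fst z) > 0" "snd (snd z) > 0" if "z \<in> D" for z
    using that \<rho> by (auto simp: D_def dist_real_def)
  have center: "((y0, t0), (x0, t0)) \<in> D" using \<rho> by (simp add: D_def)
  have F_cont: "continuous_on D F"
    unfolding F_def case_prod_beta
    using D_pos
    by (force intro!: continuous_intros continuous_on_compose2[OF cu]
        continuous_on_compose2[OF cont(1)] continuous_on_compose2[OF cont(2)]
        continuous_on_compose2[OF cont(3)] simp: less_imp_le)
  \<comment> \<open>For equal times \<open>le\<close> leaves only the quadratic terms, so on the
    diagonal \<open>F\<close> can be nonnegative at the centre alone.\<close>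
  have F_diag: "F ((y, t), (x, t)) \<le> - (norm (y - y0))\<^sup>2 - (norm (x - x0))\<^sup>2 - (t - t0)\<^sup>2"
    if "((y, t), (x, t)) \<in> D" for x y t
    using le[of t y x] that D_pos[OF that] \<rho> by (auto simp: F_def D_def dist_real_def abs_minus_commute)
  have F_center: "F ((y0, t0), (x0, t0)) = 0"
    using eq by (simp add: F_def c_def)
  have "\<exists>z\<in>D. \<forall>w\<in>D. F w - real n * (snd (fst w) - snd (snd w))\<^sup>2 \<le> F z - real n * (snd (fst z) - snd (snd z))\<^sup>2" for n
    by (rule continuous_attains_sup[OF D_compact]) (use center F_cont in \<open>auto intro!: continuous_intros\<close>)
  then obtain Z where ZD: "\<And>n. Z n \<in> D" and
    Zmax: "\<And>n w. w \<in> D \<Longrightarrow> F w - real n * (snd (fst w) - snd (snd w))\<^sup>2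
       \<le> F (Z n) - real n * (snd (fst (Z n)) - snd (snd (Z n)))\<^sup>2"
    by metis
  obtain l r where l: "l \<in> D" and r: "strict_mono (r :: nat \<Rightarrow> nat)" and lim: "(Z \<circ> r) \<longlonglongrightarrow> l"
    using compact_imp_seq_compact[OF D_compact] ZD unfolding seq_compact_def by metis
  have F_lim: "(\<lambda>n. F (Z (r n))) \<longlonglongrightarrow> F l"
    using continuous_on_tendsto_compose[OF F_cont lim l] ZD by (auto simp: o_def)
  \<comment> \<open>Comparison with the centre, where \<open>F\<close> and the penalty both vanish.
    It forces the two times together and makes \<open>F\<close> nonnegative in the limit.\<close>
  have bound: "real n * (snd (fst (Z n)) - snd (snd (Z n)))\<^sup>2 \<le> F (Z n)" for n
    using Zmax[OF center, of n] F_center by simp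
  obtain B where B: "\<And>z. z \<in> D \<Longrightarrow> F z \<le> B"
    using continuous_attains_sup[OF D_compact _ F_cont] center by (metis empty_iff)
  have F_nonneg: "F l \<ge> 0"
    using F_lim bound by (intro LIMSEQ_le_const[OF F_lim]) (meson mult_nonneg_nonneg of_nat_0_le_iff order_trans zero_le_power2)
  have B0: "B \<ge> 0" using B[OF center] F_center by simp
  have diag: "snd (fst l) = snd (snd l)"
  proof -
    have "(\<lambda>n. (snd (fst (Z (r n))) - snd (snd (Z (r n))))\<^sup>2) \<longlonglongrightarrow> (snd (fst l) - snd (snd l))\<^sup>2"
      using lim unfolding o_def by (intro tendsto_intros)
    moreover have "(\<lambda>n. (snd (fst (Z (r n))) - snd (snd (Z (r n))))\<^sup>2) \<longlonglongrightarrow> 0"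
    proof (rule tendsto_sandwich[OF _ _ tendsto_const])
      show "(\<lambda>n. B / real n) \<longlonglongrightarrow> 0" by (rule lim_const_over_n)
      show "\<forall>\<^sub>F n in sequentially. (snd (fst (Z (r n))) - snd (snd (Z (r n))))\<^sup>2 \<le> B / real n"
        using eventually_gt_at_top[of 0]
      proof eventually_elim
        case (elim n)
        have "real n * (snd (fst (Z (r n))) - snd (snd (Z (r n))))\<^sup>2
            \<le> real (r n) * (snd (fst (Z (r n))) - snd (snd (Z (r n))))\<^sup>2"
          using seq_suble[OF r, of n] by (intro mult_right_mono) auto
        also have "\<dots> \<le> B" using bound B[OF ZD] order_trans by blast
        finally show ?case using elim by (simp add: field_simps)
      qed
    qed auto
    ultimately have "(snd (fst l) - snd (snd l))\<^sup>2 = 0" by (rule LIMSEQ_unique)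
    then show ?thesis by simp
  qed
  have l_eq: "l = ((y0, t0), (x0, t0))"
  proof -
    obtain y t x where ll: "l = ((y, t), (x, t))" using diag by (metis prod.collapse)
    have "0 \<le> - (norm (y - y0))\<^sup>2 - (norm (x - x0))\<^sup>2 - (t - t0)\<^sup>2"
      using F_diag[of y t x] l F_nonneg ll by simp
    moreover have "(norm (y - y0))\<^sup>2 \<ge> 0" "(norm (x - x0))\<^sup>2 \<ge> 0" "(t - t0)\<^sup>2 \<ge> 0" by auto
    ultimately have "(norm (y - y0))\<^sup>2 = 0" "(norm (x - x0))\<^sup>2 = 0" "(t - t0)\<^sup>2 = 0" by linarith+
    then show ?thesis using ll by simp
  qed
  define y t x s where "y n = fst (fst (Z (r n)))" and "t n = snd (fst (Z (r n)))"
    and "x n = fst (snd (Z (r n)))" and "s n = snd (snd (Z (r n)))" for n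
  have Zr: "Z (r n) = ((y n, t n), (x n, s n))" for n by (simp add: y_def t_def x_def s_def)
  have lims: "y \<longlonglongrightarrow> y0" "t \<longlonglongrightarrow> t0" "x \<longlonglongrightarrow> x0" "s \<longlonglongrightarrow> t0"
  proof -
    have "(Z \<circ> r) \<longlonglongrightarrow> ((y0, t0), (x0, t0))" using lim l_eq by simp
    from tendsto_fst[OF tendsto_fst[OF this]] tendsto_snd[OF tendsto_fst[OF this]]
      tendsto_fst[OF tendsto_snd[OF this]] tendsto_snd[OF tendsto_snd[OF this]]
    show "y \<longlonglongrightarrow> y0" "t \<longlonglongrightarrow> t0" "x \<longlonglongrightarrow> x0" "s \<longlonglongrightarrow> t0"
      by (simp_all add: o_def y_def[abs_def] t_def[abs_def] x_def[abs_def] s_def[abs_def])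
  qed
  define cn an qn where "cn n = u (x n, s n) $ i" and "an n = 1 + K (t n) * norm (y n - x n)"
    and "qn n = (\<kappa> (t n) + K (t n) * cn n) *\<^sub>R sgn (y n - x n)" for n
  define E where "E n = norm (y n - x n) * (\<kappa>' (t n) + K' (t n) * cn n) + \<theta>' (t n) + 2 * (t n - t0)
     + H i (y n) (qn n + 2 *\<^sub>R (y n - y0)) (u (y n, t n))
     - an n * H i (x n) ((1 / an n) *\<^sub>R (qn n - 2 *\<^sub>R (x n - x0))) (u (x n, s n))" for n
  have E_nonpos: "\<forall>\<^sub>F n in sequentially. E n \<le> 0"
  proof -
    have "\<forall>\<^sub>F n in sequentially. y n \<in> ball y0 \<rho> \<and> t n \<in> ball t0 \<rho> \<and> x n \<in> ball x0 \<rho> \<and> s n \<in> ball t0 \<rho>"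
      using lims[THEN topological_tendstoD, of "ball _ \<rho>"] \<rho>(1) by (intro eventually_conj) auto
    then show ?thesis
    proof eventually_elim
      case (elim n)
      have b1: "ball y0 \<rho> \<times> ball t0 \<rho> \<subseteq> cball y0 \<rho> \<times> cball t0 \<rho>"
        and b2: "ball x0 \<rho> \<times> ball t0 \<rho> \<subseteq> cball x0 \<rho> \<times> cball t0 \<rho>" by auto
      have in_D: "(z, w) \<in> D" if "z \<in> ball y0 \<rho> \<times> ball t0 \<rho>" "w \<in> ball x0 \<rho> \<times> ball t0 \<rho>" for z w
        using that b1 b2 unfolding D_def by blast
      have Gmax: "G (real (r n)) (fst z) (snd z) (fst w) (snd w) \<le> G (real (r n)) (y n) (t n) (x n) (s n)"
        if "z \<in> ball y0 \<rho> \<times> ball t0 \<rho>" "w \<in> ball x0 \<rho> \<times> ball t0 \<rho>" for z w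
        using Zmax[OF in_D[OF that], of "r n"] by (simp add: G_F Zr)
      have xy: "x n \<noteq> y n"
      proof
        assume *: "x n = y n"
        have "norm (y0 - x0) \<le> dist y0 (y n) + dist x0 (x n)"
          using * dist_triangle2[of y0 x0 "y n"] by (simp add: dist_norm)
        then show False using elim \<rho>(4) by (simp add: dist_commute)
      qed
      show ?case
        unfolding E_def qn_def an_def cn_def
      proof (rule doubling_at_maximum[OF sol \<kappa> K \<theta> K_nonneg _ _ xy, where n = "real (r n)"], goal_cases)
        case 7
        have "\<forall>\<^sub>F z in nhds (y n, t n). z \<in> ball y0 \<rho> \<times> ball t0 \<rho>"
          using elim by (intro eventually_nhds_in_open open_Times) auto
        then show ?case
          by eventually_elim (use elim Gmax[where w = "(x n, s n)"] in \<open>auto simp: G_def\<close>)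
      next
        case 8
        have "\<forall>\<^sub>F z in nhds (x n, s n). z \<in> ball x0 \<rho> \<times> ball t0 \<rho>"
          using elim by (intro eventually_nhds_in_open open_Times) auto
        then show ?case
          by eventually_elim (use elim Gmax[where z = "(y n, t n)"] in \<open>auto simp: G_def\<close>)
      qed (use elim \<rho> in \<open>auto simp: dist_real_def\<close>)
    qed
  qed
  have iso: "isCont \<kappa> t0" "isCont K t0" "isCont \<kappa>' t0" "isCont K' t0" "isCont \<theta>' t0"
    using cont \<kappa>(2) K(2) \<theta>(2) \<open>t0 > 0\<close> by (auto simp: continuous_on_eq_continuous_at)
  have ucont: "isCont u (z, t0)" for z
  proof -
    have "continuous_on (UNIV \<times> {0<..}) u" using cu by (rule continuous_on_subset) auto
    then show ?thesis using \<open>t0 > 0\<close> by (simp add: continuous_on_eq_continuous_at open_Times)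
  qed
  have u_lims: "(\<lambda>n. u (x n, s n)) \<longlonglongrightarrow> u (x0, t0)" "(\<lambda>n. u (y n, t n)) \<longlonglongrightarrow> u (y0, t0)"
    using lims by (auto intro!: isCont_tendsto_compose[OF ucont] tendsto_intros)
  have cn: "cn \<longlonglongrightarrow> c" unfolding cn_def[abs_def] c_def by (intro tendsto_intros u_lims)
  have \<kappa>n: "(\<lambda>n. \<kappa> (t n)) \<longlonglongrightarrow> \<kappa> t0" and Kn: "(\<lambda>n. K (t n)) \<longlonglongrightarrow> K t0"
    using iso lims(2) by (auto intro: isCont_tendsto_compose)
  have an: "an \<longlonglongrightarrow> a" unfolding an_def[abs_def] a_def by (intro tendsto_intros Kn lims)
  have a_pos: "a > 0" unfolding a_def using K_nonneg[OF \<open>t0 > 0\<close>] by (simp add: add_pos_nonneg)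
  have qn: "qn \<longlonglongrightarrow> q" unfolding qn_def[abs_def] q_def
    using ne by (intro tendsto_intros \<kappa>n Kn cn lims) auto
  have H_lim: "(\<lambda>n. H i (X n) (Q n) (V n)) \<longlonglongrightarrow> H i X0 Q0 V0"
    if "X \<longlonglongrightarrow> X0" "Q \<longlonglongrightarrow> Q0" "V \<longlonglongrightarrow> V0" for X Q V X0 Q0 V0
    using continuous_on_tendsto_compose[OF H_cont tendsto_Pair[OF that(1) tendsto_Pair[OF that(2) that(3)]]]
    by simp
  have "E \<longlonglongrightarrow> norm (y0 - x0) * (\<kappa>' t0 + K' t0 * c) + \<theta>' t0 + 2 * (t0 - t0)
     + H i y0 (q + 2 *\<^sub>R (y0 - y0)) (u (y0, t0))
     - a * H i x0 ((1 / a) *\<^sub>R (q - 2 *\<^sub>R (x0 - x0))) (u (x0, t0))"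
    unfolding E_def[abs_def] using a_pos
    by (intro tendsto_intros H_lim lims cn an qn u_lims isCont_tendsto_compose[OF iso(3)]
        isCont_tendsto_compose[OF iso(4)] isCont_tendsto_compose[OF iso(5)]) auto
  then show ?thesis
    using tendsto_upperbound[OF _ E_nonpos] by force
qed

section \<open>Structure of the system\<close>

lemma int_lattice_translate_unit_cube:
  fixes x :: "real^'n"
  obtains k where "k \<in> int_lattice" "x + k \<in> cbox 0 1"
proof
  show "(\<chi> j. - of_int \<lfloor>x $ j\<rfloor>) \<in> int_lattice" by (simp add: int_lattice_def)
  show "x + (\<chi> j. - of_int \<lfloor>x $ j\<rfloor>) \<in> cbox 0 1"
  proof -
    have "0 \<le> x $ j - of_int \<lfloor>x $ j\<rfloor> \<and> x $ j - of_int \<lfloor>x $ j\<rfloor> \<le> 1" for j by linarith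
    then show ?thesis by (simp add: mem_box_cart)
  qed
qed

lemma unit_cube_neighbour:
  fixes x y :: "real^'n"
  assumes "x \<in> cbox 0 1" "norm (y - x) \<le> 1"
  shows "y \<in> cbox (- 1) 2"
proof -
  have "\<bar>y $ j - x $ j\<bar> \<le> 1" for j
    using assms(2) component_le_norm_cart[of "y - x" j] by simp
  then have "-1 \<le> y $ j \<and> y $ j \<le> 2" for j
    using assms(1) by (simp add: mem_box_cart) (smt (verit))
  then show ?thesis by (simp add: mem_box_cart)
qed

lemma cylinder_bounded:
  fixes u :: "(real^'n) \<times> real \<Rightarrow> real^'m::finite"
  assumes "continuous_on_cylinder u"
  obtains M where "M \<ge> 1" "\<And>x t i. \<lbrakk>0 \<le> t; t \<le> T\<rbrakk> \<Longrightarrow> \<bar>u (x, t) $ i\<bar> \<le> M"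
proof -
  have "compact (cbox (0::real^'n) 1 \<times> {0..T})" by (intro compact_Times) auto
  moreover have "continuous_on (cbox (0::real^'n) 1 \<times> {0..T}) u"
    using assms unfolding continuous_on_cylinder_def by (auto elim: continuous_on_subset)
  ultimately have "bounded (u ` (cbox 0 1 \<times> {0..T}))"
    by (intro compact_imp_bounded compact_continuous_image)
  then obtain B where B: "\<And>z. z \<in> cbox 0 1 \<times> {0..T} \<Longrightarrow> norm (u z) \<le> B"
    by (auto simp: bounded_iff)
  have "\<bar>u (x, t) $ i\<bar> \<le> max B 1" if "0 \<le> t" "t \<le> T" for x t i
  proof -
    obtain k where k: "k \<in> int_lattice" "x + k \<in> cbox 0 1"
      by (rule int_lattice_translate_unit_cube)
    have "u (x + k, t) = u (x, t)"
      using assms k(1) that unfolding continuous_on_cylinder_def periodic_def by blast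
    moreover have "norm (u (x + k, t)) \<le> B" using B k that by auto
    ultimately show ?thesis using component_le_norm_cart[of "u (x, t)" i] by simp
  qed
  then show ?thesis using that[of "max B 1"] by auto
qed

lemma cylinder_uniformly_continuous:
  fixes u :: "(real^'n) \<times> real \<Rightarrow> real^'m::finite"
  assumes "continuous_on_cylinder u" "e > 0"
  obtains d where "d > 0" "\<And>x y t i. \<lbrakk>0 \<le> t; t \<le> T; norm (y - x) < d\<rbrakk> \<Longrightarrow> \<bar>u (y, t) $ i - u (x, t) $ i\<bar> < e"
proof -
  \<comment> \<open>The lattice translation moves \<open>x\<close> into the unit cube, while
    \<open>y\<close> is only known to stay within distance 1 of it; hence the larger box.\<close>
  let ?Q = "cbox (- 1 :: real^'n) 2 \<times> {0..T}"
  have "compact ?Q" by (intro compact_Times) auto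
  moreover have "continuous_on ?Q u"
    using assms unfolding continuous_on_cylinder_def by (auto elim: continuous_on_subset)
  ultimately have "uniformly_continuous_on ?Q u" by (rule compact_uniformly_continuous[rotated])
  then obtain d where d: "d > 0" "\<And>z z'. \<lbrakk>z \<in> ?Q; z' \<in> ?Q; dist z' z < d\<rbrakk> \<Longrightarrow> dist (u z') (u z) < e"
    using \<open>e > 0\<close> unfolding uniformly_continuous_on_def by metis
  have "\<bar>u (y, t) $ i - u (x, t) $ i\<bar> < e" if "0 \<le> t" "t \<le> T" "norm (y - x) < min d 1" for x y t i
  proof -
    obtain k where k: "k \<in> int_lattice" "x + k \<in> cbox 0 1"
      by (rule int_lattice_translate_unit_cube)
    have per: "u (x + k, t) = u (x, t)" "u (y + k, t) = u (y, t)"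
      using assms k(1) that unfolding continuous_on_cylinder_def periodic_def by blast+
    have "x + k \<in> cbox (- 1) 2" "y + k \<in> cbox (- 1) 2"
      using that by (auto intro!: unit_cube_neighbour[OF k(2)])
    then have "dist (u (y + k, t)) (u (x + k, t)) < e"
      using that by (intro d(2)) (auto simp: dist_Pair_Pair dist_norm)
    then show ?thesis
      using component_le_norm_cart[of "u (y, t) - u (x, t)" i] by (simp add: per dist_norm)
  qed
  then show ?thesis using that[of "min d 1"] d(1) by auto
qed

text \<open>Since \<open>p / a\<close> lies between \<open>\<lambda> p\<close> and \<open>p\<close>, convexity compares \<open>a f (p / a)\<close> with \<open>f (\<lambda> p)\<close>,
  which for small \<open>\<lambda>\<close> is negligible against \<open>\<lambda> f p\<close> because \<open>f\<close> grows like a power \<open>r > 1\<close>.\<close>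

lemma convex_scaling_gain:
  fixes f :: "'a::real_normed_vector \<Rightarrow> real"
  assumes conv: "strictly_convex f"
    and lower: "\<And>p. norm p powr r / A - A \<le> f p" and upper: "\<And>p. f p \<le> A * norm p powr r"
    and l: "0 < l" "l < 1 / 2" "A * l powr r \<le> l / (2 * A)" and "A > 0" and a: "1 \<le> a" "a \<le> 2"
    and big: "4 * A\<^sup>2 \<le> norm p powr r"
  shows "(a - 1) * (l / (4 * A) * norm p powr r) \<le> f p - a * f ((1 / a) *\<^sub>R p)"
proof (cases "a = 1")
  case False
  define R where "R = norm p powr r"
  \<comment> \<open>The weight that makes \<open>p / a\<close> a convex combination of
    \<open>p\<close> and \<open>l p\<close>: it solves \<open>(1 - s) + s * l = 1 / a\<close>, and
    lies strictly between 0 and 1 because \<open>a > 1\<close> and \<open>a * l < 1\<close>.\<close>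
  define s where "s = (1 - 1 / a) / (1 - l)"
  have a1: "a > 1" using False a by simp
  have "p \<noteq> 0" using big \<open>A > 0\<close> by auto
  then have "p \<noteq> l *\<^sub>R p" using l by (metis less_irrefl less_trans one_less_numeral_iff scaleR_cancel_right scaleR_one half_gt_zero divide_less_eq_1_pos semiring_norm(76) zero_less_numeral)
  moreover have "a * l < 1" using mult_right_mono[OF a(2) less_imp_le[OF l(1)]] l(2) by linarith
  then have "0 < s" "s < 1" using a1 l by (auto simp: s_def field_simps)
  moreover have "(1 - s) *\<^sub>R p + s *\<^sub>R (l *\<^sub>R p) = (1 / a) *\<^sub>R p"
  proof -
    have "s * (1 - l) = 1 - 1 / a" using l by (simp add: s_def)
    then have "(1 - s) + s * l = 1 / a" by (simp add: algebra_simps)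
    then show ?thesis by (metis scaleR_add_left scaleR_scaleR)
  qed
  ultimately have "f ((1 / a) *\<^sub>R p) \<le> (1 - s) * f p + s * f (l *\<^sub>R p)"
    using conv unfolding strictly_convex_def by (metis less_imp_le)
  then have "a * f ((1 / a) *\<^sub>R p) \<le> a * ((1 - s) * f p + s * f (l *\<^sub>R p))"
    using a by (intro mult_left_mono) auto
  moreover have "f p - a * ((1 - s) * f p + s * f (l *\<^sub>R p)) = (a - 1) / (1 - l) * (l * f p - f (l *\<^sub>R p))"
  proof -
    have "1 - a * (1 - s) = (a - 1) / (1 - l) * l" "a * s = (a - 1) / (1 - l)"
      using a1 l by (auto simp: s_def field_simps)
    moreover have "f p - a * ((1 - s) * f p + s * f (l *\<^sub>R p)) = (1 - a * (1 - s)) * f p - a * s * f (l *\<^sub>R p)"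
      by (simp add: algebra_simps)
    ultimately show ?thesis by (simp add: algebra_simps)
  qed
  \<comment> \<open>Of \<open>l * R / A\<close>, the additive constant in the lower bound costs at
    most a quarter by \<open>big\<close>, and the value at \<open>l p\<close> at most a half by the
    choice of \<open>l\<close>. A quarter remains.\<close>
  moreover have "l / (4 * A) * R \<le> l * f p - f (l *\<^sub>R p)"
  proof -
    have "f (l *\<^sub>R p) \<le> A * (l powr r * R)" using upper[of "l *\<^sub>R p"] l by (simp add: powr_mult R_def)
    also have "\<dots> \<le> l / (2 * A) * R" using mult_right_mono[OF l(3), of R] by (simp add: R_def)
    finally have 1: "f (l *\<^sub>R p) \<le> l / (2 * A) * R" .
    have "l * (R / A - A) \<le> l * f p" using lower[of p] l by (intro mult_left_mono) (auto simp: R_def)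
    moreover have "l * A \<le> l * (R / (4 * A))"
      using big l \<open>A > 0\<close> by (intro mult_left_mono) (auto simp: R_def field_simps power2_eq_square)
    ultimately show ?thesis using 1 by (simp add: field_simps)
  qed
  then have "(a - 1) * (l / (4 * A) * R) \<le> (a - 1) / (1 - l) * (l * f p - f (l *\<^sub>R p))"
  proof -
    assume *: "l / (4 * A) * R \<le> l * f p - f (l *\<^sub>R p)"
    have "0 \<le> l / (4 * A) * R" using l \<open>A > 0\<close> by (simp add: R_def)
    moreover have "a - 1 \<le> (a - 1) / (1 - l)" using a1 l by (simp add: field_simps)
    ultimately show ?thesis using * a1 by (intro mult_mono) auto
  qed
  ultimately show ?thesis unfolding R_def by linarith
qed simp

lemma scaling_parameter_exists:
  fixes A r :: real
  assumes "r > 1" "A > 1"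
  obtains l where "0 < l" "l < 1 / 2" "A * l powr r \<le> l / (2 * A)"
proof -
  \<comment> \<open>The requirement amounts to
    \<open>l powr (r - 1) \<le> 1 / (2 * A\<^sup>2)\<close>, which can be met since
    \<open>r > 1\<close>; the cap \<open>1 / 4\<close> secures \<open>l < 1 / 2\<close>.\<close>
  define b where "b = (1 / (2 * A\<^sup>2)) powr (1 / (r - 1))"
  define l where "l = min (1 / 4) b"
  have "b > 0" using assms by (simp add: b_def)
  have l: "0 < l" "l \<le> b" "l < 1 / 2" using \<open>b > 0\<close> by (auto simp: l_def)
  have "l powr (r - 1) \<le> b powr (r - 1)" using l assms by (intro powr_mono2) auto
  also have "\<dots> = 1 / (2 * A\<^sup>2)" using assms by (simp add: b_def powr_powr)
  finally have "l powr (r - 1) * l \<le> 1 / (2 * A\<^sup>2) * l" using l by (intro mult_right_mono) auto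
  moreover have "l powr r = l powr (r - 1) * l" using l by (simp add: powr_diff)
  ultimately have "A * l powr r \<le> A * (1 / (2 * A\<^sup>2) * l)" using assms by (metis less_trans mult_left_mono less_imp_le zero_less_one)
  also have "\<dots> = l / (2 * A)" using assms by (simp add: field_simps power2_eq_square)
  finally show ?thesis using that l by blast
qed

lemma finite_uniform_bound:
  fixes Q :: "'m::finite \<Rightarrow> real \<Rightarrow> bool"
  assumes "\<And>i. \<exists>B. Q i B" and "\<And>i B B'. Q i B \<Longrightarrow> B \<le> B' \<Longrightarrow> Q i B'"
  obtains B where "B \<ge> 1" "\<And>i. Q i B"
proof -
  obtain b where b: "\<And>i. Q i (b i)" using assms(1) by metis
  define B where "B = max 1 (Max (range b))"
  have "b i \<le> B" for i
  proof -
    have "b i \<le> Max (range b)" by simp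
    then show ?thesis unfolding B_def by (rule max.coboundedI2)
  qed
  then show ?thesis using that[of B] assms(2)[OF b] by (auto simp: B_def)
qed

section \<open>Standing assumptions and bounds on the coupling term\<close>

locale hamilton_jacobi_system =
  fixes H :: "'m::finite \<Rightarrow> real^'n \<Rightarrow> real^'n \<Rightarrow> real^'m \<Rightarrow> real"
    and h :: "'m \<Rightarrow> real^'n \<Rightarrow> real^'n \<Rightarrow> real"
    and P :: "'m \<Rightarrow> real^'n \<Rightarrow> real^'m \<Rightarrow> real"
    and \<phi> :: "real^'n \<Rightarrow> real^'m"
    and u :: "(real^'n) \<times> real \<Rightarrow> real^'m"
    and \<Theta> r A :: real
  assumes H_C2: "\<And>i. C2_on UNIV (\<lambda>(x, p, w). H i x p w)"
    and convex: "\<And>i x w. strictly_convex (\<lambda>p. H i x p w)"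
    and \<Theta>_pos: "\<Theta> > 0"
    and H_lipschitz: "\<And>i x p v w. \<bar>H i x p v - H i x p w\<bar> \<le> \<Theta> * infnorm (v - w)"
    and P_periodic: "\<And>i w. periodic (\<lambda>x. P i x w)"
    and split: "\<And>i x p w. H i x p w = h i x p + P i x w"
    and constants: "r > 1" "A > 1"
    and growth: "\<And>i x p. norm p powr r / A - A \<le> h i x p"
                "\<And>i x p. h i x p \<le> A * norm p powr r"
    and grad: "\<And>i x p. \<exists>g. GDERIV (\<lambda>y. h i y p) x :> g \<and> norm g \<le> A * (norm p powr r + 1)"
    and solution: "viscosity_solution H \<phi> u"
begin

lemma cylinder: "continuous_on_cylinder u"
  using solution by (simp add: viscosity_solution_def viscosity_subsolution_def)

lemma h_strictly_convex: "strictly_convex (\<lambda>p. h i x p)"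
  using convex[of i x 0] unfolding strictly_convex_def split by (simp add: algebra_simps)

lemma h_lipschitz: "\<bar>h i y p - h i x p\<bar> \<le> A * (norm p powr r + 1) * norm (y - x)"
proof -
  obtain g where g: "\<And>z. GDERIV (\<lambda>y. h i y p) z :> g z" "\<And>z. norm (g z) \<le> A * (norm p powr r + 1)"
    using grad[of i p] by metis
  have "norm (h i y p - h i x p) \<le> A * (norm p powr r + 1) * norm (y - x)"
  proof (rule differentiable_bound[OF convex_UNIV, where f' = "\<lambda>z h. h \<bullet> g z"])
    show "((\<lambda>y. h i y p) has_derivative (\<lambda>h. h \<bullet> g z)) (at z within UNIV)" for z
      using g(1)[of z] by (simp add: gderiv_def)
    show "onorm (\<lambda>h. h \<bullet> g z) \<le> A * (norm p powr r + 1)" for z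
    proof (rule onorm_le)
      fix v
      have "norm (v \<bullet> g z) \<le> norm v * norm (g z)" by (simp add: Cauchy_Schwarz_ineq2)
      also have "\<dots> \<le> norm v * (A * (norm p powr r + 1))" by (intro mult_left_mono g(2) norm_ge_zero)
      finally show "norm (v \<bullet> g z) \<le> A * (norm p powr r + 1) * norm v" by (simp add: mult.commute)
    qed
  qed auto
  then show ?thesis by simp
qed

text \<open>Smoothness is assumed of \<open>H\<close>, so \<open>P\<close> is recovered as
  \<open>H\<close> minus \<open>h\<close> at \<open>p = 0\<close>. There the growth condition reads
  \<open>- A \<le> h i x 0 \<le> 0\<close>, and the gradient condition makes \<open>h\<close>
  Lipschitz in \<open>x\<close> with constant \<open>A\<close>. Periodicity reduces everything to a
  compact box, which is convex so that the mean value inequality applies to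
  \<open>H\<close>.\<close>

lemma P_bounded_lipschitz:
  obtains F where "F \<ge> 1"
    "\<And>i x w. (\<And>j. \<bar>w $ j\<bar> \<le> M) \<Longrightarrow> \<bar>P i x w\<bar> \<le> F"
    "\<And>i x y w. (\<And>j. \<bar>w $ j\<bar> \<le> M) \<Longrightarrow> norm (y - x) \<le> 1 \<Longrightarrow> \<bar>P i y w - P i x w\<bar> \<le> F * norm (y - x)"
proof -
  define Q :: "((real^'n) \<times> (real^'n) \<times> (real^'m)) set"
    where "Q = cbox (- 1) 2 \<times> {0} \<times> {w. \<forall>j. w $ j \<in> {-M..M}}"
  have box: "{w::real^'m. \<forall>j. w $ j \<in> {-M..M}} = cbox (\<chi> j. - M) (\<chi> j. M)"
    by (auto simp: mem_box_cart)
  have Q_compact: "compact Q" unfolding Q_def box by (intro compact_Times) auto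
  have Q_convex: "convex Q" unfolding Q_def box by (intro convex_Times) auto
  have h0: "- A \<le> h i x 0 \<and> h i x 0 \<le> 0" for i x
    using growth(1)[where i = i and x = x and p = 0] growth(2)[where i = i and x = x and p = 0] constants
    by simp
  define bd where "bd i F \<longleftrightarrow> (\<forall>x w. (\<forall>j. \<bar>w $ j\<bar> \<le> M) \<longrightarrow> \<bar>P i x w\<bar> \<le> F) \<and>
     (\<forall>x y w. (\<forall>j. \<bar>w $ j\<bar> \<le> M) \<and> norm (y - x) \<le> 1 \<longrightarrow> \<bar>P i y w - P i x w\<bar> \<le> F * norm (y - x))" for i F
  have "\<exists>F. bd i F" for i
  proof -
    let ?f = "\<lambda>(x, p, w). H i x p w"
    obtain f' :: "(real^'n) \<times> (real^'n) \<times> (real^'m) \<Rightarrow> _" where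
      f': "\<And>z. (?f has_derivative blinfun_apply (f' z)) (at z)" "C1_on UNIV f'"
      using H_C2[of i] unfolding C2_on_def by blast
    have "continuous_on UNIV f'"
      using f'(2) unfolding C1_on_def by (metis has_derivative_continuous continuous_at_imp_continuous_on)
    then have "bounded (f' ` Q)"
      by (intro compact_imp_bounded compact_continuous_image Q_compact) (auto elim: continuous_on_subset)
    then obtain B1 where B1: "\<And>z. z \<in> Q \<Longrightarrow> norm (f' z) \<le> B1" by (auto simp: bounded_iff)
    have "bounded (?f ` Q)"
      using H_jointly_continuous[OF H_C2[of i]]
      by (intro compact_imp_bounded compact_continuous_image Q_compact) (auto elim: continuous_on_subset)
    then obtain B2 where "\<And>y. y \<in> ?f ` Q \<Longrightarrow> norm y \<le> B2" unfolding bounded_iff by blast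
    then have B2: "\<And>z. z \<in> Q \<Longrightarrow> \<bar>?f z\<bar> \<le> B2" by (metis imageI real_norm_def)
    define F where "F = max (B2 + A) (B1 + 2 * A)"
    have *: "\<bar>P i x w\<bar> \<le> F" if w: "\<forall>j. \<bar>w $ j\<bar> \<le> M" for x w
    proof -
      obtain k where k: "k \<in> int_lattice" "x + k \<in> cbox 0 1"
        by (rule int_lattice_translate_unit_cube)
      have "(x + k, 0, w) \<in> Q"
        using w unit_cube_neighbour[OF k(2), of "x + k"] by (auto simp: Q_def abs_le_iff minus_le_iff)
      from B2[OF this] have "\<bar>P i (x + k) w\<bar> \<le> B2 + A"
        using h0[of i "x + k"] by (simp add: split abs_le_iff)
      moreover have "P i (x + k) w = P i x w" using P_periodic k(1) by (auto simp: periodic_def)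
      ultimately show ?thesis by (simp add: F_def)
    qed
    have "\<bar>P i y w - P i x w\<bar> \<le> F * norm (y - x)"
      if w: "\<forall>j. \<bar>w $ j\<bar> \<le> M" and xy: "norm (y - x) \<le> 1" for x y w
    proof -
      obtain k where k: "k \<in> int_lattice" "x + k \<in> cbox 0 1"
        by (rule int_lattice_translate_unit_cube)
      have inQ: "(x + k, 0, w) \<in> Q" "(y + k, 0, w) \<in> Q"
        using w unit_cube_neighbour[OF k(2), of "x + k"] unit_cube_neighbour[OF k(2), of "y + k"] xy
        by (auto simp: Q_def abs_le_iff minus_le_iff)
      have "norm (?f (y + k, 0, w) - ?f (x + k, 0, w)) \<le> B1 * norm ((y + k, 0::real^'n, w) - (x + k, 0, w))"
        by (rule differentiable_bound[OF Q_convex, where f' = "\<lambda>z. blinfun_apply (f' z)"])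
           (use f'(1) B1 inQ in \<open>auto simp: norm_blinfun.rep_eq intro: has_derivative_at_withinI\<close>)
      then have "\<bar>H i (y + k) 0 w - H i (x + k) 0 w\<bar> \<le> B1 * norm (y - x)"
        by (simp add: norm_Pair)
      moreover have "\<bar>h i (y + k) 0 - h i (x + k) 0\<bar> \<le> A * norm (y - x)"
        using h_lipschitz[of i "y + k" 0 "x + k"] constants by simp
      ultimately have "\<bar>P i (y + k) w - P i (x + k) w\<bar> \<le> (B1 + A) * norm (y - x)"
        by (simp add: split algebra_simps abs_le_iff)
      also have "\<dots> \<le> F * norm (y - x)" using constants by (intro mult_right_mono) (auto simp: F_def)
      finally show ?thesis using P_periodic k(1) by (auto simp: periodic_def)
    qed
    with * show ?thesis unfolding bd_def by blast
  qed
  moreover have "bd i B'" if "bd i B" "B \<le> B'" for i B B'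
  proof -
    have "B * norm (y - x) \<le> B' * norm (y - x)" for x y :: "real^'n"
      using that(2) by (intro mult_right_mono) auto
    then show ?thesis using that unfolding bd_def by (meson order_trans)
  qed
  ultimately obtain F where "F \<ge> 1" and F: "\<And>i. bd i F"
    using finite_uniform_bound[of bd] by blast
  then show ?thesis using that[of F] unfolding bd_def by blast
qed

end

section \<open>The estimate in space\<close>

text \<open>The right-hand side is cut into five equal parts \<open>W\<close>. Hypothesis
  \<open>1\<close> pays for the time derivative of the weight, \<open>2\<close> for the x-dependence
  of \<open>h\<close>, and \<open>3\<close> for the lower-order terms. As \<open>A > 1\<close>,
  \<open>2\<close> also yields \<open>Q powr r \<le> W\<close>, so comparing a lower-order term with
  \<open>Q powr r\<close> suffices. \<open>Q\<close> stands for the norm of the momentum.\<close>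

lemma coercive_term_dominates:
  fixes r c A F \<Theta> K t Q :: real
  assumes "r > 1" "c > 0" "A > 1" "F \<ge> 1" "\<Theta> > 0" "K > 0" "t > 0" "Q \<ge> 1"
    and 1: "5 / (r * c) \<le> K * Q powr (r - 1) * t"
    and 2: "5 * A / c \<le> K"
    and 3: "A + F \<le> Q powr (r - 1)" "4 * \<Theta> \<le> Q powr (r - 1)" "5 * F / c \<le> Q powr (r - 1)"
  shows "Q / (r * t) + A * (Q powr r + 1) + F + 4 * \<Theta> * Q + K * F \<le> c * K * Q powr r"
proof -
  define R where "R = Q powr (r - 1)"
  define W where "W = c * K * Q powr r / 5"
  have Qr: "Q powr r = Q * R" using assms by (simp add: R_def powr_diff)
  have R_pos: "R > 0" using assms by (simp add: R_def)
  have R_le: "R \<le> Q * R" using assms R_pos by simp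
  have "5 / (r * c) * (c * Q) \<le> K * R * t * (c * Q)"
    using 1 assms by (intro mult_right_mono) (auto simp: R_def)
  then have "Q / (r * t) \<le> W" using assms by (simp add: W_def Qr field_simps)
  moreover have cK: "A \<le> c * K / 5" using 2 assms by (simp add: field_simps)
  then have "A * Q powr r \<le> W"
    using mult_right_mono[OF cK, of "Q powr r"] by (simp add: W_def)
  moreover have "Q * R \<le> W"
    using mult_right_mono[of 1 "c * K / 5" "Q powr r"] cK assms R_pos by (simp add: W_def Qr)
  moreover have "A + F \<le> Q * R" using 3(1) R_le by (simp add: R_def)
  moreover have "4 * \<Theta> * Q \<le> Q * R"
    using mult_right_mono[OF 3(2), of Q] assms by (simp add: R_def mult_ac)
  moreover have "K * F \<le> W"
  proof -
    have "5 * F / c \<le> Q * R" using 3(3) R_le by (simp add: R_def)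
    then have "F \<le> c * (Q * R) / 5" using \<open>c > 0\<close> by (simp add: field_simps)
    from mult_left_mono[OF this, of K] assms show ?thesis by (simp add: W_def Qr mult_ac)
  qed
  ultimately have "Q / (r * t) + (A * Q powr r + A) + F + 4 * \<Theta> * Q + K * F \<le> 5 * W" by linarith
  then show ?thesis by (simp add: W_def distrib_left)
qed

lemma infnorm_le_cart:
  fixes v :: "real^'m::finite"
  assumes "\<And>j. \<bar>v $ j\<bar> \<le> b" shows "infnorm v \<le> b"
  unfolding infnorm_eq_Max using assms by (subst Max_le_iff) auto

lemma powr_neg_has_derivative:
  fixes t :: real
  assumes "t > 0"
  shows "((\<lambda>t. b * t powr (- 1 / r)) has_real_derivative (- b / r * t powr (- 1 / r - 1))) (at t)"
  using assms by (auto intro!: derivative_eq_intros simp: powr_diff)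

context hamilton_jacobi_system
begin

text \<open>The doubling inequality at a point where the gap \<theta> is attained has two kinds of
  terms. Those proportional to the distance \<open>z\<close> are settled by \<open>balance\<close>.
  The others are \<open>N * \<theta> t0\<close> from the time derivative and at most
  \<open>\<Theta> * \<theta> t0\<close> lost to the coupling, so \<open>N > \<Theta>\<close> leaves
  a strictly positive remainder.\<close>

lemma touching_contradiction:
  fixes M F l k C N \<sigma> T T1 :: real
  defines "c \<equiv> l / (4 * A)" and "\<kappa> \<equiv> \<lambda>t. C * t powr (- 1 / r)" and "K \<equiv> \<lambda>t. k * t powr (- 1 / r)"
    and "\<theta> \<equiv> \<lambda>t. \<sigma> * exp (N * (t - T))"
  assumes M: "M \<ge> 1" "\<And>x t i. \<lbrakk>0 \<le> t; t \<le> T1\<rbrakk> \<Longrightarrow> \<bar>u (x, t) $ i\<bar> \<le> M"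
    and F: "F \<ge> 1" "\<And>i x w. (\<And>j. \<bar>w $ j\<bar> \<le> M) \<Longrightarrow> \<bar>P i x w\<bar> \<le> F"
      "\<And>i x y w. (\<And>j. \<bar>w $ j\<bar> \<le> M) \<Longrightarrow> norm (y - x) \<le> 1 \<Longrightarrow> \<bar>P i y w - P i x w\<bar> \<le> F * norm (y - x)"
    and l: "0 < l" "l < 1 / 2" "A * l powr r \<le> l / (2 * A)"
    and k: "k > 0" "C \<ge> 4 * M * k" and K1: "\<And>t. \<lbrakk>0 < t; t \<le> T1\<rbrakk> \<Longrightarrow> K t \<ge> 1"
    and balance: "\<And>t Q. \<lbrakk>0 < t; t \<le> T1; \<kappa> t / 2 \<le> Q\<rbrakk> \<Longrightarrow> 4 * A\<^sup>2 \<le> Q powr r \<and>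
       Q / (r * t) + A * (Q powr r + 1) + F + 4 * \<Theta> * Q + K t * F \<le> c * K t * Q powr r"
    and N: "N > \<Theta>" and \<sigma>: "\<sigma> > 0" and t0: "0 < t0" "t0 < T1"
    and le: "\<And>i x y t. \<lbrakk>0 < t; t \<le> T1\<rbrakk> \<Longrightarrow>
       u (y, t) $ i \<le> u (x, t) $ i + norm (y - x) * (\<kappa> t + K t * u (x, t) $ i) + \<theta> t"
    and eq: "u (y0, t0) $ i = u (x0, t0) $ i + norm (y0 - x0) * (\<kappa> t0 + K t0 * u (x0, t0) $ i) + \<theta> t0"
  shows False
proof -
  define z where "z = norm (y0 - x0)"
  define Q where "Q = \<kappa> t0 + K t0 * u (x0, t0) $ i"
  define a where "a = 1 + K t0 * z"
  define q where "q = Q *\<^sub>R sgn (y0 - x0)"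
  have \<theta>_pos: "\<theta> t > 0" for t using \<sigma> by (simp add: \<theta>_def)
  have ne: "x0 \<noteq> y0" using eq \<theta>_pos[of t0] by auto
  have z_pos: "z > 0" using ne by (simp add: z_def)
  have Kt: "K t0 \<ge> 1" using K1 t0 by simp
  have \<kappa>K: "4 * M * K t0 \<le> \<kappa> t0"
    using mult_right_mono[OF k(2), of "t0 powr (- 1 / r)"] by (simp add: K_def \<kappa>_def)
  have Kw: "\<bar>K t0 * u (x, t0) $ j\<bar> \<le> \<kappa> t0 / 4" for x j
  proof -
    have "\<bar>K t0 * u (x, t0) $ j\<bar> = K t0 * \<bar>u (x, t0) $ j\<bar>" using Kt by (simp add: abs_mult)
    also have "\<dots> \<le> K t0 * M" using M(2) t0 Kt by (intro mult_left_mono) auto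
    also have "\<dots> = 4 * M * K t0 / 4" by simp
    also have "\<dots> \<le> \<kappa> t0 / 4" using \<kappa>K by (intro divide_right_mono) auto
    finally show ?thesis .
  qed
  have \<kappa>_pos: "\<kappa> t0 > 0" by (rule less_le_trans[OF _ \<kappa>K]) (use Kt M(1) in \<open>intro mult_pos_pos; simp\<close>)
  have Q_ge: "\<kappa> t0 / 2 \<le> Q" using Kw[of x0 i] \<kappa>_pos by (simp add: Q_def abs_le_iff)
  have Q_pos: "Q > 0" using Q_ge \<kappa>_pos by simp
  have \<kappa>_Q: "\<kappa> t0 + K t0 * u (x, t0) $ j \<le> 4 * Q" for x j
    using Kw[of x j] Q_ge \<kappa>_pos by (simp add: abs_le_iff)
  \<comment> \<open>The touching equality bounds \<open>z * Q\<close> by the oscillation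
    \<open>2 * M\<close>, while \<open>Q\<close> is at least \<open>\<kappa> t0 / 2\<close>, hence
    at least \<open>2 * M * K t0\<close>. Consequently \<open>a \<le> 2\<close>, as the convexity
    gain requires, and since \<open>K t0 \<ge> 1\<close> also \<open>z \<le> 1\<close>, as the
    Lipschitz bound for \<open>P\<close> requires.\<close>
  have Kz: "K t0 * z \<le> 1"
  proof -
    have "z * (\<kappa> t0 / 2) \<le> z * Q" using Q_ge z_pos by simp
    also have "\<dots> \<le> 2 * M"
      using eq \<theta>_pos[of t0] M(2)[of t0 y0 i] M(2)[of t0 x0 i] t0 by (simp add: z_def Q_def abs_le_iff)
    finally have "z * (4 * M * K t0) \<le> 4 * M" using mult_left_mono[OF \<kappa>K less_imp_le[OF z_pos]] by linarith
    then have "(4 * M) * (K t0 * z) \<le> (4 * M) * 1" by (simp add: mult_ac)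
    then show ?thesis using M(1) by (simp only: mult_le_cancel_left_pos)
  qed
  have z1: "z \<le> 1" using Kz mult_right_mono[OF Kt less_imp_le[OF z_pos]] by linarith
  have a: "1 \<le> a" "a \<le> 2" "a - 1 = K t0 * z" using Kz Kt z_pos by (auto simp: a_def)
  have norm_q: "norm q = Q" using Q_pos ne by (simp add: q_def norm_sgn)
  have bal: "4 * A\<^sup>2 \<le> Q powr r"
    "Q / (r * t0) + A * (Q powr r + 1) + F + 4 * \<Theta> * Q + K t0 * F \<le> c * K t0 * Q powr r"
    using balance[OF t0(1) _ Q_ge] t0 by auto
  define \<kappa>' K' where "\<kappa>' t = - C / r * t powr (- 1 / r - 1)" and "K' t = - k / r * t powr (- 1 / r - 1)" for t
  have cont': "continuous_on {0<..} (\<lambda>t::real. b * t powr e)" for b e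
    by (auto intro!: continuous_intros)
  have "z * (\<kappa>' t0 + K' t0 * u (x0, t0) $ i) + N * \<theta> t0
     + H i y0 q (u (y0, t0)) - a * H i x0 ((1 / a) *\<^sub>R q) (u (x0, t0)) \<le> 0"
    unfolding z_def a_def q_def Q_def
  proof (rule doubling_inequality[OF solution H_jointly_continuous[OF H_C2]])
    show "(\<kappa> has_real_derivative \<kappa>' t) (at t)" "(K has_real_derivative K' t) (at t)" if "t > 0" for t
      using powr_neg_has_derivative[OF that] unfolding \<kappa>_def K_def \<kappa>'_def K'_def by auto
    show "continuous_on {0<..} \<kappa>'" "continuous_on {0<..} K'" "continuous_on {0<..} (\<lambda>t. N * \<theta> t)"
      unfolding \<kappa>'_def K'_def \<theta>_def using constants by (auto intro!: cont' continuous_intros)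
    show "(\<theta> has_real_derivative N * \<theta> t) (at t)" for t
      unfolding \<theta>_def by (auto intro!: derivative_eq_intros)
    show "K t \<ge> 0" for t using k by (simp add: K_def)
    show "T1 - t0 > 0" using t0 by simp
    show "u (y, t) $ i \<le> u (x, t) $ i + norm (y - x) * (\<kappa> t + K t * u (x, t) $ i) + \<theta> t"
      if "t > 0" "\<bar>t - t0\<bar> \<le> T1 - t0" for x y t
      using le[of t y i x] that by simp
  qed (use t0 ne eq in auto)
  \<comment> \<open>Both weights are multiples of \<open>t powr (- 1 / r)\<close>, so
    differentiation multiplies their combination \<open>Q\<close> by
    \<open>- 1 / (r * t0)\<close>.\<close>
  moreover have "\<kappa>' t0 + K' t0 * u (x0, t0) $ i = - (Q / (r * t0))"
    using t0 by (simp add: \<kappa>'_def K'_def Q_def \<kappa>_def K_def powr_diff field_simps add_divide_distrib)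
  moreover have "- (A * (Q powr r + 1) * z) \<le> h i y0 q - h i x0 q"
    using h_lipschitz[of i y0 q x0] by (simp add: norm_q z_def abs_le_iff)
  moreover have "K t0 * z * (c * Q powr r) \<le> h i x0 q - a * h i x0 ((1 / a) *\<^sub>R q)"
    using convex_scaling_gain[OF h_strictly_convex growth l _ a(1,2), of q i x0] constants bal(1)
    by (simp add: norm_q a(3) c_def)
  moreover have "- (\<Theta> * (4 * Q * z + \<theta> t0)) - F * z - K t0 * z * F \<le> P i y0 (u (y0, t0)) - a * P i x0 (u (x0, t0))"
  proof -
    \<comment> \<open>The maximum was taken over all components and all pairs of points, so
      \<open>le\<close> may be used for any \<open>j\<close> and with the two points exchanged;
      together this bounds the maximum norm of the difference.\<close>
    have "u (y, t0) $ j - u (x, t0) $ j \<le> z * (4 * Q) + \<theta> t0" if "norm (y - x) = z" for x y j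
      using le[OF t0(1) less_imp_le[OF t0(2)], of y j x] mult_left_mono[OF \<kappa>_Q[of x j] less_imp_le[OF z_pos]]
      unfolding that by linarith
    from this[of y0 x0] this[of x0 y0] have "infnorm (u (y0, t0) - u (x0, t0)) \<le> 4 * Q * z + \<theta> t0"
      by (intro infnorm_le_cart) (auto simp: abs_le_iff z_def norm_minus_commute mult_ac)
    from mult_left_mono[OF this less_imp_le[OF \<Theta>_pos]] have "\<bar>P i y0 (u (y0, t0)) - P i y0 (u (x0, t0))\<bar> \<le> \<Theta> * (4 * Q * z + \<theta> t0)"
      using H_lipschitz[of i y0 0 "u (y0, t0)" "u (x0, t0)"] by (simp only: split)
    moreover have "\<bar>P i y0 (u (x0, t0)) - P i x0 (u (x0, t0))\<bar> \<le> F * z"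
      unfolding z_def using M(2) t0 z1 by (intro F(3)) (auto simp: z_def)
    moreover have "\<bar>(a - 1) * P i x0 (u (x0, t0))\<bar> \<le> K t0 * z * F"
      unfolding abs_mult using F(2)[of "u (x0, t0)" i x0] M(2) t0 a by (intro mult_mono) auto
    moreover have "P i y0 (u (y0, t0)) - a * P i x0 (u (x0, t0)) = (P i y0 (u (y0, t0)) - P i y0 (u (x0, t0)))
       + (P i y0 (u (x0, t0)) - P i x0 (u (x0, t0))) - (a - 1) * P i x0 (u (x0, t0))"
      by (simp add: algebra_simps)
    ultimately show ?thesis by linarith
  qed
  moreover have "z * (Q / (r * t0) + A * (Q powr r + 1) + F + 4 * \<Theta> * Q + K t0 * F) \<le> z * (c * K t0 * Q powr r)"
    using bal(2) z_pos by (intro mult_left_mono) auto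
  moreover have "(N - \<Theta>) * \<theta> t0 > 0" using N \<theta>_pos by simp
  ultimately show False unfolding split by (simp add: algebra_simps)
qed

end

text \<open>\<open>k\<close> makes \<open>K\<close> at least \<open>5 * A / c\<close> up to time
  \<open>T1\<close>. Each summand of \<open>C\<close> meets one demand: \<open>4 * M * k\<close>
  keeps the weight comparable to \<kappa>, \<open>Z\<close> beats the time derivative, and
  \<open>Y\<close> beats the lower-order terms. The last two are doubled because \<open>Q\<close> is
  only at least half of \<kappa>; the factor \<open>T1 powr (1 / r)\<close> compensates the smallest
  value of \<open>t powr (- 1 / r)\<close>.\<close>

lemma spatial_estimate_constants:
  fixes r c A F \<Theta> M T1 :: real
  assumes "r > 1" "0 < c" "c < 1" "A > 1" "F \<ge> 1" "\<Theta> > 0" "M \<ge> 1" "T1 > 0"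
  obtains k C :: real where "k > 0" "C \<ge> 4 * M * k"
    "\<And>t. \<lbrakk>0 < t; t \<le> T1\<rbrakk> \<Longrightarrow> k * t powr (- 1 / r) \<ge> 1"
    "\<And>t Q. \<lbrakk>0 < t; t \<le> T1; C * t powr (- 1 / r) / 2 \<le> Q\<rbrakk> \<Longrightarrow> 4 * A\<^sup>2 \<le> Q powr r \<and>
       Q / (r * t) + A * (Q powr r + 1) + F + 4 * \<Theta> * Q + k * t powr (- 1 / r) * F
         \<le> c * (k * t powr (- 1 / r)) * Q powr r"
proof -
  define k where "k = max 1 (5 * A / c * T1 powr (1 / r))"
  define X where "X = A + F + 4 * \<Theta> + 5 * F / c + 4 * A\<^sup>2"
  define Y where "Y = max 1 (X powr (1 / (r - 1)))"
  define Z where "Z = (5 / (r * c)) powr (1 / (r - 1))"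
  define C where "C = 4 * M * k + 2 * Z + 2 * Y * T1 powr (1 / r)"
  have X_pos: "X > 0" using assms by (simp add: X_def add_pos_pos)
  have Y: "Y \<ge> 1" "X powr (1 / (r - 1)) \<le> Y" by (auto simp: Y_def)
  have Z: "Z > 0" using assms by (simp add: Z_def)
  have k: "k \<ge> 1" "5 * A / c * T1 powr (1 / r) \<le> k" by (auto simp: k_def)
  have Mk: "4 * M * k \<ge> 0" using assms k by simp
  have YT: "2 * Y * T1 powr (1 / r) \<ge> 0" using Y by simp
  have powr_t: "T1 powr (- 1 / r) \<le> t powr (- 1 / r)" if "0 < t" "t \<le> T1" for t
    using that assms by (intro powr_mono2') auto
  have TT: "T1 powr (1 / r) * T1 powr (- 1 / r) = 1"
    using assms by (simp add: powr_minus)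
  have K_ge: "5 * A / c \<le> k * t powr (- 1 / r)" if "0 < t" "t \<le> T1" for t
  proof -
    have "5 * A / c = 5 * A / c * T1 powr (1 / r) * T1 powr (- 1 / r)" using TT by (simp add: mult.assoc)
    also have "\<dots> \<le> k * t powr (- 1 / r)" using k powr_t[OF that] by (intro mult_mono) auto
    finally show ?thesis .
  qed
  have Ac: "1 \<le> 5 * A / c" using assms by (simp add: field_simps)
  show ?thesis
  proof
    show "k > 0" using k by simp
    show "C \<ge> 4 * M * k" using Z YT by (simp add: C_def)
    show "k * t powr (- 1 / r) \<ge> 1" if "0 < t" "t \<le> T1" for t
      using K_ge[OF that] Ac by linarith
    show "4 * A\<^sup>2 \<le> Q powr r \<and>
       Q / (r * t) + A * (Q powr r + 1) + F + 4 * \<Theta> * Q + k * t powr (- 1 / r) * F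
         \<le> c * (k * t powr (- 1 / r)) * Q powr r"
      if t: "0 < t" "t \<le> T1" and Q: "C * t powr (- 1 / r) / 2 \<le> Q" for t Q
    proof -
      define p where "p = t powr (- 1 / r)"
      have p_pos: "p > 0" using t by (simp add: p_def)
      have Zp: "Z * p \<le> Q"
      proof -
        have "Z * p \<le> C / 2 * p" using p_pos Mk YT by (intro mult_right_mono) (auto simp: C_def)
        then show ?thesis using Q by (simp add: p_def)
      qed
      have YQ: "Y \<le> Q"
      proof -
        have "Y = Y * T1 powr (1 / r) * T1 powr (- 1 / r)" using TT by (simp add: mult.assoc)
        also have "\<dots> \<le> C / 2 * p"
          using powr_t[OF t] Y(1) Mk Z by (intro mult_mono) (auto simp: C_def p_def)
        finally show ?thesis using Q by (simp add: p_def)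
      qed
      then have Q1: "Q \<ge> 1" using Y by simp
      have XQ: "X \<le> Q powr (r - 1)"
      proof -
        have "X = (X powr (1 / (r - 1))) powr (r - 1)" using assms X_pos by (simp add: powr_powr)
        also have "\<dots> \<le> Q powr (r - 1)" using YQ Y assms by (intro powr_mono2) auto
        finally show ?thesis .
      qed
      have "Q powr (r - 1) \<le> Q powr r" using Q1 by (intro powr_mono) auto
      moreover have parts: "A + F \<le> X" "4 * \<Theta> \<le> X" "5 * F / c \<le> X" "4 * A\<^sup>2 \<le> X"
        using assms by (auto simp: X_def add_nonneg_nonneg)
      ultimately have "4 * A\<^sup>2 \<le> Q powr r" using XQ by linarith
      moreover have "5 / (r * c) \<le> k * p * Q powr (r - 1) * t"
      proof -
        have "5 / (r * c) = Z powr (r - 1)" using assms by (simp add: Z_def powr_powr)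
        also have "\<dots> = p * (Z * p) powr (r - 1) * t"
        proof -
          \<comment> \<open>Here the exponent matters: for \<open>p = t powr (- 1 / r)\<close> all
            powers of \<open>t\<close> cancel, so \<open>Z\<close> can be chosen independently of
            \<open>t\<close>.\<close>
          have "p * p powr (r - 1) * t = p powr r * t" using p_pos by (simp add: powr_diff)
          also have "p powr r = t powr (- 1)" using assms by (simp add: p_def powr_powr)
          also have "\<dots> * t = 1" using t by (simp add: powr_minus)
          finally have "p * p powr (r - 1) * t = 1" .
          then show ?thesis using Z p_pos by (simp add: powr_mult mult_ac)
        qed
        also have "\<dots> \<le> k * p * Q powr (r - 1) * t"
        proof (rule mult_right_mono[OF mult_mono])
          show "p \<le> k * p" using k p_pos by simp
          show "(Z * p) powr (r - 1) \<le> Q powr (r - 1)"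
            using Zp Z p_pos assms by (intro powr_mono2) auto
        qed (use k p_pos t in auto)
        finally show ?thesis .
      qed
      then have "Q / (r * t) + A * (Q powr r + 1) + F + 4 * \<Theta> * Q + k * p * F \<le> c * (k * p) * Q powr r"
        using assms t Q1 K_ge[OF t] k p_pos parts XQ
        by (intro coercive_term_dominates) (auto simp: p_def)
      ultimately show ?thesis by (simp add: p_def)
    qed
  qed
qed

context hamilton_jacobi_system
begin

text \<open>It suffices that \<open>G \<le> 0\<close>, because the weight is at most
  \<open>2 * \<kappa> t\<close>. If \<open>G\<close> takes a value \<open>g0 > 0\<close>, the
  weighted function \<open>V\<close> has a maximum \<sigma> \<ge> \<open>g0\<close> over components,
  displacements, base points and times. As \<open>V < g0\<close> at early times and at
  \<open>T1\<close>, the maximum is interior in time, which \<open>touching_contradiction\<close>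
  excludes.\<close>

lemma spatial_estimate:
  assumes "T > 0"
  obtains C where "C > 0"
    "\<And>x y t i. \<lbrakk>0 < t; t \<le> T\<rbrakk> \<Longrightarrow> \<bar>u (y, t) $ i - u (x, t) $ i\<bar> \<le> C * t powr (- 1 / r) * norm (y - x)"
proof -
  define T1 where "T1 = T + 1"
  have T1: "T1 > 0" "T < T1" using assms by (auto simp: T1_def)
  obtain M where M: "M \<ge> 1" "\<And>x t i. \<lbrakk>0 \<le> t; t \<le> T1\<rbrakk> \<Longrightarrow> \<bar>u (x, t) $ i\<bar> \<le> M"
    by (rule cylinder_bounded[OF cylinder, of T1]) blast
  obtain F where F: "F \<ge> 1" "\<And>i x w. (\<And>j. \<bar>w $ j\<bar> \<le> M) \<Longrightarrow> \<bar>P i x w\<bar> \<le> F"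
      "\<And>i x y w. (\<And>j. \<bar>w $ j\<bar> \<le> M) \<Longrightarrow> norm (y - x) \<le> 1 \<Longrightarrow> \<bar>P i y w - P i x w\<bar> \<le> F * norm (y - x)"
    by (rule P_bounded_lipschitz[of M]) blast
  obtain l where l: "0 < l" "l < 1 / 2" "A * l powr r \<le> l / (2 * A)"
    by (rule scaling_parameter_exists[OF constants]) blast
  define c where "c = l / (4 * A)"
  have c: "0 < c" "c < 1" using l constants by (auto simp: c_def field_simps)
  obtain k C where k: "k > 0" "C \<ge> 4 * M * k"
    and K1: "\<And>t. \<lbrakk>0 < t; t \<le> T1\<rbrakk> \<Longrightarrow> k * t powr (- 1 / r) \<ge> 1"
    and balance: "\<And>t Q. \<lbrakk>0 < t; t \<le> T1; C * t powr (- 1 / r) / 2 \<le> Q\<rbrakk> \<Longrightarrow> 4 * A\<^sup>2 \<le> Q powr r \<and>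
       Q / (r * t) + A * (Q powr r + 1) + F + 4 * \<Theta> * Q + k * t powr (- 1 / r) * F
         \<le> c * (k * t powr (- 1 / r)) * Q powr r"
    by (rule spatial_estimate_constants[OF constants(1) c constants(2) F(1) \<Theta>_pos M(1) T1(1)]) blast
  define \<kappa> K where "\<kappa> t = C * t powr (- 1 / r)" and "K t = k * t powr (- 1 / r)" for t
  define G where "G i x y t = u (y, t) $ i - u (x, t) $ i - norm (y - x) * (\<kappa> t + K t * u (x, t) $ i)" for i x y t
  have Mk: "4 * M * k > 0" using M(1) k(1) by simp
  have C_pos: "C > 0" using Mk k(2) by linarith
  have K_pos: "K t > 0" "\<kappa> t > 0" if "t > 0" for t using k C_pos that by (auto simp: K_def \<kappa>_def)
  have weight: "\<kappa> t / 2 \<le> \<kappa> t + K t * u (x, t) $ i" "\<kappa> t + K t * u (x, t) $ i \<le> 2 * \<kappa> t"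
    if "0 < t" "t \<le> T1" for x t i
  proof -
    have "K t * \<bar>u (x, t) $ i\<bar> \<le> K t * M" using M(2)[of t x i] that K_pos(1)[of t] by (intro mult_left_mono) auto
    moreover have "4 * M * K t \<le> \<kappa> t"
      using mult_right_mono[OF k(2), of "t powr (- 1 / r)"] by (simp add: K_def \<kappa>_def)
    moreover have "\<bar>K t * u (x, t) $ i\<bar> = K t * \<bar>u (x, t) $ i\<bar>" using K_pos(1)[OF that(1)] by (simp add: abs_mult)
    moreover have "K t * M > 0" using K_pos(1)[OF that(1)] M(1) by simp
    moreover have "4 * M * K t = 4 * (K t * M)" by simp
    ultimately show "\<kappa> t / 2 \<le> \<kappa> t + K t * u (x, t) $ i" "\<kappa> t + K t * u (x, t) $ i \<le> 2 * \<kappa> t"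
      by linarith+
  qed
  have G_close: "norm (y - x) * \<kappa> t < 4 * M" if "G i x y t > 0" "0 < t" "t \<le> T1" for i x y t
  proof -
    have "norm (y - x) * (\<kappa> t / 2) \<le> norm (y - x) * (\<kappa> t + K t * u (x, t) $ i)"
      using weight(1)[OF that(2,3)] by (intro mult_left_mono) auto
    also have "\<dots> < 2 * M" using that(1) M(2)[of t y i] M(2)[of t x i] that by (simp add: G_def abs_le_iff)
    finally show ?thesis by simp
  qed
  have G_diff: "G i x y t \<le> \<bar>u (y, t) $ i - u (x, t) $ i\<bar>" if "0 < t" "t \<le> T1" for i x y t
  proof -
    have "0 \<le> norm (y - x) * (\<kappa> t + K t * u (x, t) $ i)"
      using weight(1)[OF that, of x i] K_pos(2)[OF that(1)] by (intro mult_nonneg_nonneg) auto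
    then show ?thesis by (simp add: G_def)
  qed
  have M2: "\<bar>u (y, t) $ i - u (x, t) $ i\<bar> \<le> 2 * M" if "0 \<le> t" "t \<le> T1" for x y t i
    using abs_triangle_ineq4[of "u (y, t) $ i" "u (x, t) $ i"] M(2)[OF that, of y i] M(2)[OF that, of x i] by linarith
  have G_le: "G i x y t \<le> 0" if "0 < t" "t \<le> T" for i x y t
  proof (rule ccontr)
    assume neg: "\<not> G i x y t \<le> 0"
    define g0 where "g0 = G i x y t"
    have g0: "g0 > 0" using neg by (simp add: g0_def)
    \<comment> \<open>The first entry serves the coupling. The second serves the end
      \<open>T1 = T + 1\<close>: there \<open>V\<close> is at most \<open>2 * M * exp (- N)\<close>,
      below \<open>g0\<close> because \<open>exp N > N \<ge> 2 * M / g0\<close>.\<close>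
    define N where "N = max (\<Theta> + 1) (2 * M / g0)"
    have N: "N > \<Theta>" "N > 0" "2 * M / g0 \<le> N" using \<Theta>_pos by (auto simp: N_def)
    \<comment> \<open>With the displacement \<open>z\<close> as a variable, \<open>V\<close> is
      periodic in \<open>x\<close> for fixed \<open>z\<close>, so \<open>x\<close> can be moved into
      the unit cube.\<close>
    define V where "V i z x t = G i x (x + z) t * exp (- N * (t - T))" for i x z t
    have V_start: "g0 \<le> V i (y - x) x t"
      unfolding V_def using that N g0 by (simp add: g0_def[symmetric] mult_nonneg_nonpos)
    have V_end: "V j z x T1 < g0" for j z x
    proof -
      have "G j x (x + z) T1 \<le> 2 * M"
        using order_trans[OF G_diff M2, of T1 j x "x + z"] T1 by simp
      then have "V j z x T1 \<le> 2 * M * exp (- N)" by (simp add: V_def T1_def)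
      also have "\<dots> < g0"
      proof -
        have "2 * M \<le> N * g0" using N(3) g0 by (simp add: field_simps)
        also have "N < exp N" using exp_ge_add_one_self[of N] by linarith
        then have "N * g0 < exp N * g0" using g0 by simp
        finally show ?thesis by (simp add: exp_minus field_simps)
      qed
      finally show ?thesis .
    qed
    obtain d where d: "d > 0" "\<And>x y t i. \<lbrakk>0 \<le> t; t \<le> T1; norm (y - x) < d\<rbrakk> \<Longrightarrow>
        \<bar>u (y, t) $ i - u (x, t) $ i\<bar> < g0 * exp (- N * T)"
      using cylinder_uniformly_continuous[OF cylinder, of "g0 * exp (- N * T)" T1] g0
      by (metis exp_gt_zero mult_pos_pos)
    \<comment> \<open>Up to this time \<open>\<kappa> s * d \<ge> 4 * M\<close>, so by
      \<open>G_close\<close> a positive \<open>G\<close> forces \<open>norm z < d\<close>. The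
      tolerance \<open>g0 * exp (- N * T)\<close> that belongs to \<open>d\<close> offsets the
      largest possible weight \<open>exp (N * T)\<close>.\<close>
    define t1 where "t1 = min T ((4 * M / (C * d)) powr (- r))"
    have t1: "0 < t1" "t1 \<le> T" "t1 \<le> (4 * M / (C * d)) powr (- r)"
      using assms M(1) C_pos d(1) by (auto simp: t1_def)
    have V_early: "V j z x s < g0" if s: "0 < s" "s \<le> t1" for j z x s
    proof (cases "G j x (x + z) s > 0")
      case True
      have "4 * M / (C * d) = ((4 * M / (C * d)) powr (- r)) powr (- 1 / r)"
        using constants M(1) C_pos d(1) by (simp add: powr_powr)
      also have "\<dots> \<le> s powr (- 1 / r)"
        using s t1 constants by (intro powr_mono2') auto
      finally have "4 * M \<le> \<kappa> s * d" using C_pos d(1) by (simp add: \<kappa>_def field_simps)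
      moreover have "norm z * \<kappa> s < 4 * M" using G_close[OF True] s t1 T1 by simp
      ultimately have "\<kappa> s * norm z < \<kappa> s * d" by (simp add: mult.commute)
      then have "norm z < d" using K_pos(2)[OF s(1)] by (simp add: mult_less_cancel_left_pos)
      then have "G j x (x + z) s < g0 * exp (- N * T)"
        using G_diff[of s j x "x + z"] d(2)[of s "x + z" x j] s t1 T1 by simp
      moreover have "exp (- N * (s - T)) \<le> exp (N * T)" using N s by (simp add: algebra_simps)
      ultimately have "V j z x s < g0 * exp (- N * T) * exp (N * T)"
        unfolding V_def using True g0 by (intro mult_strict_right_mono[THEN less_le_trans] mult_left_mono) auto
      then show ?thesis by (simp add: mult.assoc flip: exp_add)
    next
      case False
      then have "V j z x s \<le> 0" by (simp add: V_def mult_nonpos_nonneg)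
      then show ?thesis using g0 by simp
    qed
    define S where "S = cball (0::real^'n) 1 \<times> cbox (0::real^'n) 1 \<times> {t1..T1}"
    have S_compact: "compact S" unfolding S_def by (intro compact_Times) auto
    have cu: "continuous_on (UNIV \<times> {0..}) u" using cylinder by (simp add: continuous_on_cylinder_def)
    have V_cont: "continuous_on S (\<lambda>(z, x, t). V j z x t)" for j
      unfolding V_def G_def \<kappa>_def K_def case_prod_beta
      using t1(1) by (force intro!: continuous_intros continuous_on_compose2[OF cu] simp: S_def)
    have S_ne: "S \<noteq> {}"
    proof -
      have "(0, 0, t1) \<in> S" using t1 T1 by (auto simp: S_def mem_box_cart)
      then show ?thesis by blast
    qed
    have "\<exists>p\<in>S. \<forall>p'\<in>S. (\<lambda>(z, x, t). V j z x t) p' \<le> (\<lambda>(z, x, t). V j z x t) p" for j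
      by (rule continuous_attains_sup[OF S_compact S_ne V_cont])
    then obtain p where p: "\<And>j. p j \<in> S" "\<And>j p'. p' \<in> S \<Longrightarrow> (\<lambda>(z, x, t). V j z x t) p' \<le> (\<lambda>(z, x, t). V j z x t) (p j)"
      by metis
    define m where "m j = (\<lambda>(z, x, t). V j z x t) (p j)" for j
    have "Max (range m) \<in> range m" by (intro Max_in) auto
    then obtain j0 where "Max (range m) = m j0" by blast
    moreover have "m j \<le> Max (range m)" for j by simp
    ultimately have j0: "m j \<le> m j0" for j by simp
    define \<sigma> where "\<sigma> = m j0"
    \<comment> \<open>Reduction to the compact set \<open>S\<close>: a positive \<open>G\<close>
      gives \<open>norm z < 1\<close> because \<open>\<kappa> s \<ge> 4 * M\<close>, and early times
      fall under \<open>V_early\<close>. The \<open>0\<close> in the maximum accounts for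
      nonpositive \<open>G\<close> and disappears once \<open>\<sigma> \<ge> g0\<close> is
      known.\<close>
    have small: "V j z x s \<le> max \<sigma> 0 \<or> V j z x s < g0" if s: "0 < s" "s \<le> T1" for j z x s
    proof (cases "G j x (x + z) s > 0 \<and> t1 < s")
      case True
      have "norm z * \<kappa> s < 4 * M" using G_close[of j x "x + z" s] True s by simp
      moreover have "4 * M \<le> \<kappa> s"
      proof -
        have "4 * M * 1 \<le> 4 * M * (k * s powr (- 1 / r))" using K1[OF s] M(1) by (intro mult_left_mono) auto
        also have "\<dots> = 4 * M * k * s powr (- 1 / r)" by (simp only: mult.assoc)
        also have "\<dots> \<le> \<kappa> s" unfolding \<kappa>_def by (intro mult_right_mono k) auto
        finally show ?thesis by simp
      qed
      ultimately have "\<kappa> s * norm z < \<kappa> s * 1" by (simp add: mult.commute)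
      then have z: "norm z \<le> 1" using K_pos(2)[OF s(1)] by (simp add: mult_less_cancel_left_pos)
      obtain k' where k': "k' \<in> int_lattice" "x + k' \<in> cbox 0 1"
        by (rule int_lattice_translate_unit_cube)
      have per: "u (x' + k', s) = u (x', s)" for x'
        using cylinder k'(1) s unfolding continuous_on_cylinder_def periodic_def by simp
      have "V j z x s = V j z (x + k') s"
        unfolding V_def G_def using per[of x] per[of "x + z"] by (simp add: algebra_simps)
      also have "\<dots> \<le> m j" using p(2)[of "(z, x + k', s)" j] z k' True s by (simp add: m_def S_def)
      finally show ?thesis using j0[of j] by (auto simp: \<sigma>_def le_max_iff_disj)
    next
      case False
      then show ?thesis
      proof (cases "G j x (x + z) s > 0")
        case True
        then show ?thesis using V_early[of s j z x] False s by simp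
      next
        case False
        then have "V j z x s \<le> 0" by (simp add: V_def mult_nonpos_nonneg)
        then show ?thesis by (simp add: le_max_iff_disj)
      qed
    qed
    have \<sigma>_ge: "g0 \<le> \<sigma>" using small[of t i "y - x" x] V_start that T1 g0 by auto
    have V_le: "V j z x s \<le> \<sigma>" if "0 < s" "s \<le> T1" for j z x s
      using small[OF that, of j z x] \<sigma>_ge g0 by auto
    obtain z0 x0 t0 where p0: "p j0 = (z0, x0, t0)" by (metis prod.collapse)
    have V0: "V j0 z0 x0 t0 = \<sigma>" by (simp add: \<sigma>_def m_def p0)
    have t0: "t1 \<le> t0" "t0 \<le> T1" using p(1)[of j0] by (auto simp: p0 S_def)
    have t0': "0 < t0" "t0 < T1"
      using t0 t1 V_end[of j0 z0 x0] V0 \<sigma>_ge by (auto simp: less_le)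
    have G_eq: "G j x (x + z) s = V j z x s * exp (N * (s - T))" for j x z s
      by (simp add: V_def mult.assoc exp_add[symmetric] algebra_simps)
    show False
    proof (rule touching_contradiction[where M = M and F = F and l = l and k = k and C = C and N = N
          and \<sigma> = \<sigma> and T = T and ?T1.0 = T1 and ?t0.0 = t0 and ?x0.0 = x0 and ?y0.0 = "x0 + z0" and i = j0])
      show "u (y, s) $ j \<le> u (x, s) $ j + norm (y - x) * (C * s powr (- 1 / r) + k * s powr (- 1 / r) * u (x, s) $ j)
        + \<sigma> * exp (N * (s - T))" if "0 < s" "s \<le> T1" for j x y s
      proof -
        have "G j x y s \<le> \<sigma> * exp (N * (s - T))"
          using G_eq[of j x "y - x" s] V_le[OF that, of j "y - x" x] by simp
        then show ?thesis by (simp add: G_def \<kappa>_def K_def)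
      qed
      show "u (x0 + z0, t0) $ j0 = u (x0, t0) $ j0 + norm (x0 + z0 - x0) *
        (C * t0 powr (- 1 / r) + k * t0 powr (- 1 / r) * u (x0, t0) $ j0) + \<sigma> * exp (N * (t0 - T))"
        using G_eq[of j0 x0 z0 t0] V0 by (simp add: G_def \<kappa>_def K_def)
      show "\<sigma> > 0" using \<sigma>_ge g0 by simp
    qed (use M F l k K1 balance[unfolded c_def] N t0' in auto)
  qed
  have "\<bar>u (y, t) $ i - u (x, t) $ i\<bar> \<le> 2 * C * t powr (- 1 / r) * norm (y - x)" if t: "0 < t" "t \<le> T" for x y t i
  proof -
    have "u (y, t) $ i - u (x, t) $ i \<le> 2 * C * t powr (- 1 / r) * norm (y - x)" for x y
    proof -
      have "u (y, t) $ i - u (x, t) $ i \<le> norm (y - x) * (\<kappa> t + K t * u (x, t) $ i)"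
        using G_le[OF t, of i x y] by (simp add: G_def)
      also have "\<dots> \<le> norm (y - x) * (2 * \<kappa> t)" using weight(2)[of t x i] t T1 by (intro mult_left_mono) auto
      finally show ?thesis by (simp add: \<kappa>_def mult_ac)
    qed
    from this[of y x] this[of x y] show ?thesis by (simp add: abs_le_iff norm_minus_commute)
  qed
  then show ?thesis using that[of "2 * C"] C_pos by simp
qed

end

section \<open>The estimate in time\<close>

text \<open>Along \<open>x - s q\<close> the function decreases at rate
  \<open>(norm q)\<^sup>2\<close>, while the lower bound allows at most \<open>L * norm q\<close>.
  The lemma bounds gradients of test functions that touch a Lipschitz function from above.\<close>

lemma gradient_bound_from_below:
  assumes D: "GDERIV f x :> q" and L: "L \<ge> 0"
    and below: "\<forall>\<^sub>F y in nhds x. f x - L * norm (y - x) \<le> f y"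
  shows "norm q \<le> L"
proof (cases "q = 0")
  case False
  have lim: "((\<lambda>s. x - s *\<^sub>R q) \<longlongrightarrow> x - 0 *\<^sub>R q) (at_right 0)" by (intro tendsto_intros)
  have "((\<lambda>s. x - s *\<^sub>R q) has_derivative (\<lambda>h. - (h *\<^sub>R q))) (at 0)"
    by (auto intro!: derivative_eq_intros)
  moreover have "(f has_derivative (\<lambda>h. h \<bullet> q)) (at (x - 0 *\<^sub>R q))" using D by (simp add: gderiv_def)
  ultimately have "((\<lambda>s. f (x - s *\<^sub>R q)) has_derivative (\<lambda>h. - (h *\<^sub>R q) \<bullet> q)) (at 0)"
    by (rule has_derivative_compose)
  moreover have "(\<lambda>h. - (h *\<^sub>R q) \<bullet> q) = (*) (- (norm q)\<^sup>2)"
    by (auto simp: fun_eq_iff power2_norm_eq_inner)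
  ultimately have "((\<lambda>s. f (x - s *\<^sub>R q)) has_real_derivative - (norm q)\<^sup>2) (at 0)"
    by (simp only: has_field_derivative_def)
  then have "((\<lambda>s. (f (x - s *\<^sub>R q) - f x) / s) \<longlongrightarrow> - (norm q)\<^sup>2) (at_right 0)"
    by (simp add: has_field_derivative_iff) (meson filterlim_at_within_not_equal filterlim_mono at_le subset_UNIV order_refl tendsto_mono)
  moreover have "\<forall>\<^sub>F s in at_right 0. - (L * norm q) \<le> (f (x - s *\<^sub>R q) - f x) / s"
    using eventually_compose_filterlim[OF below lim[simplified]] eventually_at_right_less[of 0]
    by eventually_elim (simp add: field_simps)
  ultimately have "- (L * norm q) \<le> - (norm q)\<^sup>2"
    by (intro tendsto_lowerbound) auto
  then show ?thesis using False by (simp add: power2_eq_square)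
qed (use L in simp)

text \<open>A larger increment would let a barrier \<psi> of time slope greater than
  \<open>B\<close> touch \<open>w\<close> from above. The quadratic term of \<psi> keeps the
  touching point near \<open>x0\<close>, the exponential term keeps it away from \<open>T\<close>,
  and the excess slope \<eta> contradicts \<open>touch\<close>.\<close>

lemma time_growth_bound:
  fixes w :: "(real^'n) \<times> real \<Rightarrow> real"
  assumes cont: "continuous_on (UNIV \<times> {0..}) w"
    and bound: "\<And>x t. \<lbrakk>0 \<le> t; t \<le> T\<rbrakk> \<Longrightarrow> \<bar>w (x, t)\<bar> \<le> M"
    and times: "0 \<le> a" "a \<le> b" "b < T" and "B \<ge> 0"
    and touch: "\<And>x t \<psi> g q \<tau>. \<lbrakk>a < t; t < T; \<And>z. GDERIV \<psi> z :> g z; continuous_on UNIV g; g (x, t) = (q, \<tau>);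
       \<forall>\<^sub>F z in nhds (x, t). w z - \<psi> z \<le> w (x, t) - \<psi> (x, t)\<rbrakk> \<Longrightarrow> \<tau> \<le> B"
  shows "w (x0, b) - w (x0, a) \<le> B * (b - a)"
proof (rule ccontr)
  assume neg: "\<not> w (x0, b) - w (x0, a) \<le> B * (b - a)"
  define gap where "gap = w (x0, b) - w (x0, a) - B * (b - a)"
  \<comment> \<open>So \<open>gap\<close> equals \<open>\<eta> * (b - a)\<close> for the excess
    slope plus three further units: one for the exponential term at \<open>b\<close>, one for the
    variation of \<open>w\<close> near \<open>x0\<close> at time \<open>a\<close>, and one for
    strictness.\<close>
  define \<eta> where "\<eta> = gap / (3 + (b - a))"
  have "gap > 0" using neg by (simp add: gap_def)
  then have \<eta>: "\<eta> > 0" using times by (simp add: \<eta>_def)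
  have "\<eta> * (3 + (b - a)) = gap" using times by (simp add: \<eta>_def)
  then have gap: "\<eta> * (b - a) + 2 * \<eta> < gap" using \<eta> by (simp add: algebra_simps)
  have "isCont (\<lambda>x. w (x, a)) x0"
  proof -
    have "continuous_on UNIV (\<lambda>x. w (x, a))"
      using times by (auto intro!: continuous_on_compose2[OF cont] continuous_intros)
    then show ?thesis by (simp add: continuous_on_eq_continuous_at)
  qed
  then obtain \<delta> where \<delta>: "\<delta> > 0" "\<And>x. norm (x - x0) < \<delta> \<Longrightarrow> \<bar>w (x, a) - w (x0, a)\<bar> < \<eta>"
    using \<eta> unfolding continuous_at_eps_delta by (metis dist_norm dist_real_def)
  \<comment> \<open>\<open>N\<close> lifts the quadratic term above the oscillation
    \<open>2 * M\<close> both at distance 1 and at distance \<delta>; \<open>L\<close> does the same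
    for the exponential term at time \<open>T\<close>, although that term is only \<eta> at time
    \<open>b\<close>.\<close>
  define N where "N = 2 * M + 2 * M / \<delta>\<^sup>2"
  define L where "L = 2 * M / (\<eta> * (T - b))"
  have M: "M \<ge> 0" using bound[of a undefined] times by simp
  have N: "N \<ge> 2 * M" "N * \<delta>\<^sup>2 \<ge> 2 * M" "N \<ge> 0"
    using M \<delta>(1) by (auto simp: N_def distrib_right)
  have L: "L \<ge> 0" "\<eta> * (L * (T - b)) = 2 * M" using M \<eta> times by (auto simp: L_def)
  define \<psi> where "\<psi> z = N * (norm (fst z - x0))\<^sup>2 + ((B + \<eta>) * (snd z - a) + \<eta> * exp (L * (snd z - b)))"
    for z :: "(real^'n) \<times> real"
  define g where "g z = (N *\<^sub>R 2 *\<^sub>R (fst z - x0), (B + \<eta>) + \<eta> * (exp (L * (snd z - b)) * L))"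
    for z :: "(real^'n) \<times> real"
  define D where "D = cball x0 1 \<times> {a..T}"
  have "compact D" unfolding D_def by (intro compact_Times) auto
  moreover have in_D: "(x0, b) \<in> D" using times by (simp add: D_def)
  moreover have "continuous_on D w" using cont times by (rule_tac continuous_on_subset[OF cont]) (auto simp: D_def)
  then have "continuous_on D (\<lambda>z. w z - \<psi> z)"
    unfolding \<psi>_def by (intro continuous_intros)
  ultimately obtain z1 where z1: "z1 \<in> D" "\<And>z. z \<in> D \<Longrightarrow> w z - \<psi> z \<le> w z1 - \<psi> z1"
    using continuous_attains_sup[of D "\<lambda>z. w z - \<psi> z"] by blast
  obtain x1 t1 where zz: "z1 = (x1, t1)" by (cases z1)
  have dom: "norm (x1 - x0) \<le> 1" "a \<le> t1" "t1 \<le> T"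
    using z1(1) by (auto simp: zz D_def dist_norm norm_minus_commute)
  have w1: "\<bar>w (x1, t1)\<bar> \<le> M" and w0: "\<bar>w (x0, a)\<bar> \<le> M" using bound dom times by auto
  have high: "w (x0, a) + \<eta> < w (x1, t1) - \<psi> (x1, t1)"
  proof -
    have "w (x0, b) - \<psi> (x0, b) = w (x0, a) + gap - \<eta> * (b - a) - \<eta>"
      by (simp add: \<psi>_def gap_def algebra_simps)
    then show ?thesis using z1(2)[OF in_D] gap by (simp add: zz)
  qed
  have parts: "0 \<le> N * (norm (x1 - x0))\<^sup>2" "0 \<le> (B + \<eta>) * (t1 - a)" "0 \<le> \<eta> * exp (L * (t1 - b))"
    using N \<eta> \<open>B \<ge> 0\<close> dom by auto
  have \<psi>1: "\<psi> (x1, t1) = N * (norm (x1 - x0))\<^sup>2 + ((B + \<eta>) * (t1 - a) + \<eta> * exp (L * (t1 - b)))"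
    by (simp add: \<psi>_def)
  have "norm (x1 - x0) \<noteq> 1"
  proof
    assume "norm (x1 - x0) = 1"
    then have "N * (norm (x1 - x0))\<^sup>2 = N" by simp
    then show False using high parts N w1 w0 \<eta> unfolding \<psi>1 by linarith
  qed
  moreover have "t1 \<noteq> a"
  proof
    assume "t1 = a"
    show False
    proof (cases "norm (x1 - x0) < \<delta>")
      case True
      then show ?thesis using \<delta>(2)[OF True] high parts \<psi>1 unfolding \<open>t1 = a\<close> by linarith
    next
      case False
      then have "N * \<delta>\<^sup>2 \<le> N * (norm (x1 - x0))\<^sup>2" using N \<delta>(1) by (intro mult_left_mono power_mono) auto
      then show ?thesis using high parts N w1 w0 \<eta> unfolding \<psi>1 by linarith
    qed
  qed
  moreover have "t1 \<noteq> T"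
  proof
    assume "t1 = T"
    have "L * (T - b) \<le> exp (L * (t1 - b))"
      using exp_ge_add_one_self[of "L * (T - b)"] unfolding \<open>t1 = T\<close> by linarith
    then have "\<eta> * (L * (T - b)) \<le> \<eta> * exp (L * (t1 - b))" using \<eta> by (intro mult_left_mono) auto
    then show False using high parts L w1 w0 \<eta> unfolding \<psi>1 by linarith
  qed
  ultimately have int: "norm (x1 - x0) < 1" "a < t1" "t1 < T" using dom by auto
  have "(B + \<eta>) + \<eta> * (exp (L * (t1 - b)) * L) \<le> B"
  proof (rule touch[OF int(2,3), of \<psi> g])
    show "GDERIV \<psi> z :> g z" for z
    proof -
      have 1: "((\<lambda>t. (B + \<eta>) * (t - a) + \<eta> * exp (L * (t - b))) has_real_derivative
          (B + \<eta>) + \<eta> * (exp (L * (snd z - b)) * L)) (at (snd z))"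
        by (auto intro!: derivative_eq_intros)
      show ?thesis unfolding \<psi>_def
        by (rule GDERIV_subst[OF GDERIV_add[OF GDERIV_mult[OF GDERIV_const GDERIV_comp_fst[OF GDERIV_dist_sq]]
              GDERIV_comp_snd[OF 1]]]) (simp add: g_def)
    qed
    show "continuous_on UNIV g" unfolding g_def by (intro continuous_intros)
    show "g (x1, t1) = (N *\<^sub>R 2 *\<^sub>R (x1 - x0), (B + \<eta>) + \<eta> * (exp (L * (t1 - b)) * L))"
      by (simp add: g_def)
    have "\<forall>\<^sub>F z in nhds (x1, t1). z \<in> ball x0 1 \<times> {a<..<T}"
      using int by (intro eventually_nhds_in_open open_Times) (auto simp: dist_norm norm_minus_commute)
    then show "\<forall>\<^sub>F z in nhds (x1, t1). w z - \<psi> z \<le> w (x1, t1) - \<psi> (x1, t1)"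
    proof eventually_elim
      case (elim z)
      then have "z \<in> D" by (auto simp: D_def)
      from z1(2)[OF this] show ?case by (simp add: zz)
    qed
  qed
  moreover have "0 \<le> \<eta> * (exp (L * (t1 - b)) * L)" using \<eta> L by simp
  ultimately show False using \<eta> by linarith
qed

text \<open>The constants belong to the intervals (0, n] and may jump with n. Each
  \<open>c k\<close> enters with a continuous coefficient that vanishes up to
  \<open>t = k - 2\<close> and is at least 1 from \<open>t = k - 1\<close> on, hence in particular
  for \<open>k\<close> the ceiling of \<open>t\<close>. Locally the sum is finite, which gives
  continuity.\<close>

lemma continuous_majorant:
  fixes c :: "nat \<Rightarrow> real"
  assumes "\<And>n. c n \<ge> 0"
  obtains D :: "real \<Rightarrow> real" where "continuous_on UNIV D" "\<And>t. D t > 0"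
    "\<And>t. t > 0 \<Longrightarrow> \<exists>n. t \<le> real n \<and> c n \<le> D t"
proof -
  define E where "E N t = 1 + (\<Sum>k<N. c k * max 0 (t - real k + 2))" for N t
  define D where "D t = E (nat \<lceil>t\<rceil> + 3) t" for t
  have stable: "E N t = D t" if "t + 2 < real N" for N t
  proof -
    have "(\<Sum>k<N. c k * max 0 (t - real k + 2)) = (\<Sum>k<nat \<lceil>t\<rceil> + 3. c k * max 0 (t - real k + 2))"
    proof (rule sum.mono_neutral_cong)
      show "c k * max 0 (t - real k + 2) = 0" if "k \<in> {..<N} - {..<nat \<lceil>t\<rceil> + 3}" for k
      proof -
        have "t + 2 \<le> real k" using that by simp linarith
        then show ?thesis by simp
      qed
      show "c k * max 0 (t - real k + 2) = 0" if "k \<in> {..<nat \<lceil>t\<rceil> + 3} - {..<N}" for k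
        using that \<open>t + 2 < real N\<close> by simp
    qed auto
    then show ?thesis by (simp add: D_def E_def)
  qed
  have nonneg: "0 \<le> c k * max 0 (t - real k + 2)" for k t using assms by simp
  show ?thesis
  proof
    have "isCont D t" for t
    proof -
      obtain N where N: "t + 3 < real N" using reals_Archimedean2 by blast
      have "continuous_on {..<t + 1} (E N)" unfolding E_def by (intro continuous_intros)
      moreover have "E N s = D s" if "s \<in> {..<t + 1}" for s using N that by (intro stable) auto
      ultimately have "continuous_on {..<t + 1} D" by (metis continuous_on_cong)
      then show ?thesis by (simp add: continuous_on_eq_continuous_at)
    qed
    then show "continuous_on UNIV D" by (simp add: continuous_on_eq_continuous_at)
    show "D t > 0" for t
      unfolding D_def E_def by (intro add_pos_nonneg sum_nonneg nonneg) simp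
    show "\<exists>n. t \<le> real n \<and> c n \<le> D t" if "t > 0" for t
    proof (intro exI conjI)
      let ?n = "nat \<lceil>t\<rceil>"
      show "t \<le> real ?n" using that by linarith
      have "real ?n < t + 1" using that by linarith
      then have "c ?n * 1 \<le> c ?n * max 0 (t - real ?n + 2)" using assms by (intro mult_left_mono) auto
      also have "\<dots> \<le> (\<Sum>k<?n + 3. c k * max 0 (t - real k + 2))"
        by (rule member_le_sum[where f = "\<lambda>k. c k * max 0 (t - real k + 2)"]) (use nonneg in auto)
      finally show "c ?n \<le> D t" by (simp add: D_def E_def)
    qed
  qed
qed

context hamilton_jacobi_system
begin

text \<open>Upward growth is limited by the subsolution property and \<open>h \<ge> - A\<close>.
  Downward growth is limited by the supersolution property, where \<open>h\<close> has to be bounded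
  above; there the spatial estimate bounds the test gradient. Passing to \<open>- u\<close> lets
  \<open>time_growth_bound\<close> serve both directions.\<close>

lemma time_estimate:
  assumes "0 < a" "a < b"
  obtains L where "L \<ge> 0"
    "\<And>x s t i. \<lbrakk>a \<le> s; s \<le> b; a \<le> t; t \<le> b\<rbrakk> \<Longrightarrow> \<bar>u (x, t) $ i - u (x, s) $ i\<bar> \<le> L * \<bar>t - s\<bar>"
proof -
  define T where "T = b + 1"
  have T: "b < T" "T > 0" using assms by (auto simp: T_def)
  obtain M where M: "M \<ge> 1" "\<And>x t i. \<lbrakk>0 \<le> t; t \<le> T\<rbrakk> \<Longrightarrow> \<bar>u (x, t) $ i\<bar> \<le> M"
    by (rule cylinder_bounded[OF cylinder, of T]) blast
  obtain F where F: "F \<ge> 1" "\<And>i x w. (\<And>j. \<bar>w $ j\<bar> \<le> M) \<Longrightarrow> \<bar>P i x w\<bar> \<le> F"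
    by (rule P_bounded_lipschitz[of M]) blast
  obtain C where C: "C > 0"
    "\<And>x y t i. \<lbrakk>0 < t; t \<le> T\<rbrakk> \<Longrightarrow> \<bar>u (y, t) $ i - u (x, t) $ i\<bar> \<le> C * t powr (- 1 / r) * norm (y - x)"
    by (rule spatial_estimate[OF T(2)]) blast
  define l where "l = C * a powr (- 1 / r)"
  have l: "l \<ge> 0" using C by (simp add: l_def)
  have lip: "\<bar>u (y, t) $ i - u (x, t) $ i\<bar> \<le> l * norm (y - x)" if "a \<le> t" "t \<le> T" for x y t i
  proof -
    have "t powr (- 1 / r) \<le> a powr (- 1 / r)" using that assms constants by (intro powr_mono2') auto
    then have "C * t powr (- 1 / r) * norm (y - x) \<le> l * norm (y - x)"
      unfolding l_def using C by (intro mult_right_mono mult_left_mono) auto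
    then show ?thesis using C(2)[of t y i x] that assms by simp
  qed
  define B where "B = A * (l powr r + 1) + F"
  have B: "B \<ge> 0" using constants F by (simp add: B_def)
  have cu: "continuous_on (UNIV \<times> {0..}) u" using cylinder by (simp add: continuous_on_cylinder_def)
  have Pb: "\<bar>P i x (u (x, t))\<bar> \<le> F" if "0 \<le> t" "t \<le> T" for i x t using F(2) M(2) that by blast
  have up: "u (x, t) $ i - u (x, s) $ i \<le> B * (t - s)" if st: "a \<le> s" "s \<le> t" "t \<le> b" for x s t i
  proof (rule time_growth_bound[where w = "\<lambda>z. u z $ i" and T = T and M = M, OF _ _ _ _ _ B])
    show "continuous_on (UNIV \<times> {0..}) (\<lambda>z. u z $ i)" by (intro continuous_intros cu)
    fix y \<tau>' q \<tau> and \<psi> :: "(real^'n) \<times> real \<Rightarrow> real" and g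
    assume *: "s < \<tau>'" "\<tau>' < T" "\<And>z. GDERIV \<psi> z :> g z" "continuous_on UNIV g" "g (y, \<tau>') = (q, \<tau>)"
      "\<forall>\<^sub>F z in nhds (y, \<tau>'). u z $ i - \<psi> z \<le> u (y, \<tau>') $ i - \<psi> (y, \<tau>')"
    have "\<tau> + H i y q (u (y, \<tau>')) \<le> 0"
      by (rule subsolution_test[where S = UNIV and \<psi> = \<psi> and g = g and \<phi> = \<phi>])
         (use solution * st assms in \<open>auto simp: viscosity_solution_def\<close>)
    moreover have "- A \<le> h i y q"
      using growth(1)[of q i y] constants by (smt (verit) divide_nonneg_pos powr_ge_zero)
    moreover have "A \<le> A * (l powr r + 1)" using constants by simp
    ultimately show "\<tau> \<le> B" using Pb[of \<tau>' i y] * st assms unfolding split B_def by linarith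
  qed (use st assms T M in auto)
  have down: "- u (x, t) $ i - - u (x, s) $ i \<le> B * (t - s)" if st: "a \<le> s" "s \<le> t" "t \<le> b" for x s t i
  proof (rule time_growth_bound[where w = "\<lambda>z. - u z $ i" and T = T and M = M, OF _ _ _ _ _ B])
    show "continuous_on (UNIV \<times> {0..}) (\<lambda>z. - u z $ i)" by (intro continuous_intros cu)
    fix y \<tau>' q \<tau> and \<psi> :: "(real^'n) \<times> real \<Rightarrow> real" and g
    assume *: "s < \<tau>'" "\<tau>' < T" "\<And>z. GDERIV \<psi> z :> g z" "continuous_on UNIV g" "g (y, \<tau>') = (q, \<tau>)"
      "\<forall>\<^sub>F z in nhds (y, \<tau>'). - u z $ i - \<psi> z \<le> - u (y, \<tau>') $ i - \<psi> (y, \<tau>')"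
    have "- \<tau> + H i y (- q) (u (y, \<tau>')) \<ge> 0"
    proof (rule supersolution_test[where S = UNIV and \<psi> = "\<lambda>z. - \<psi> z" and g = "\<lambda>z. - g z" and \<phi> = \<phi>])
      show "\<forall>\<^sub>F z in nhds (y, \<tau>'). u z $ i - - \<psi> z \<ge> u (y, \<tau>') $ i - - \<psi> (y, \<tau>')"
        using *(6) by eventually_elim simp
    qed (use solution * st assms in \<open>auto simp: viscosity_solution_def intro: GDERIV_minus continuous_intros\<close>)
    moreover have "norm q \<le> l"
    proof (rule gradient_bound_from_below[OF _ l])
      show "GDERIV (\<lambda>y. \<psi> (y, \<tau>')) y :> q" using GDERIV_slices(1) *(3,5) by metis
      have "((\<lambda>y. (y, \<tau>')) \<longlongrightarrow> (y, \<tau>')) (nhds y)" by (intro tendsto_intros filterlim_ident)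
      from eventually_compose_filterlim[OF *(6) this]
      show "\<forall>\<^sub>F y' in nhds y. \<psi> (y, \<tau>') - l * norm (y' - y) \<le> \<psi> (y', \<tau>')"
      proof eventually_elim
        case (elim y')
        then show ?case using lip[of \<tau>' y' i y] * st by (simp add: abs_le_iff)
      qed
    qed
    then have "norm (- q) powr r \<le> l powr r" using constants by (intro powr_mono2) auto
    then have "A * norm (- q) powr r \<le> A * (l powr r + 1)" using constants by (intro mult_left_mono) auto
    ultimately show "\<tau> \<le> B"
      using growth(2)[of i y "- q"] Pb[of \<tau>' i y] * st assms unfolding split B_def by linarith
  qed (use st assms T M in auto)
  have "\<bar>u (x, t) $ i - u (x, s) $ i\<bar> \<le> B * \<bar>t - s\<bar>" if "a \<le> s" "s \<le> b" "a \<le> t" "t \<le> b" for x s t i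
    using up[of s t x i] down[of s t x i] up[of t s x i] down[of t s x i] that
    by (cases "s \<le> t") (auto simp: abs_le_iff)
  then show ?thesis using that[OF B] by blast
qed

end

section \<open>Lipschitz continuity of the solution\<close>

text \<open>By periodicity the bound holds with \<open>y\<close> replaced by each translate
  \<open>y + k\<close>; division by \<open>c\<close> turns this into a lower bound for the set whose
  infimum is the torus distance.\<close>

lemma infnorm_le_torus_dist:
  fixes f :: "real^'n \<Rightarrow> real^'m::finite"
  assumes "periodic f" "c > 0" and lip: "\<And>x y i. \<bar>f y $ i - f x $ i\<bar> \<le> c * norm (y - x)"
  shows "infnorm (f x - f y) \<le> c * torus_dist x y"
proof -
  have "infnorm (f x - f y) / c \<le> torus_dist x y"
    unfolding torus_dist_def
  proof (rule cINF_greatest)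
    have "0 \<in> (int_lattice :: (real^'n) set)" by (simp add: int_lattice_def)
    then show "(int_lattice :: (real^'n) set) \<noteq> {}" by blast
    fix k :: "real^'n" assume "k \<in> int_lattice"
    then have "f (y + k) = f y" using \<open>periodic f\<close> by (auto simp: periodic_def)
    moreover have "infnorm (f x - f (y + k)) \<le> c * norm (x - (y + k))"
      using lip by (intro infnorm_le_cart) simp
    ultimately show "infnorm (f x - f y) / c \<le> dist x (y + k)"
      using \<open>c > 0\<close> by (simp add: divide_le_eq dist_norm mult.commute)
  qed
  then show ?thesis using \<open>c > 0\<close> by (simp add: divide_le_eq mult.commute)
qed

context hamilton_jacobi_system
begin

lemma solution_locally_lipschitz: "locally_lipschitz_on (UNIV \<times> {0<..}) u"
  unfolding locally_lipschitz_on_def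
proof
  fix z0 :: "(real^'n) \<times> real"
  assume "z0 \<in> UNIV \<times> {0<..}"
  then obtain x0 t0 where z0: "z0 = (x0, t0)" "t0 > 0" by auto
  define a b where "a = t0 / 2" and "b = 2 * t0"
  have ab: "0 < a" "a < b" "b > 0" using z0 by (auto simp: a_def b_def)
  obtain C where C: "C > 0"
    "\<And>x y t i. \<lbrakk>0 < t; t \<le> b\<rbrakk> \<Longrightarrow> \<bar>u (y, t) $ i - u (x, t) $ i\<bar> \<le> C * t powr (- 1 / r) * norm (y - x)"
    by (rule spatial_estimate[OF ab(3)]) blast
  obtain L where L: "L \<ge> 0"
    "\<And>x s t i. \<lbrakk>a \<le> s; s \<le> b; a \<le> t; t \<le> b\<rbrakk> \<Longrightarrow> \<bar>u (x, t) $ i - u (x, s) $ i\<bar> \<le> L * \<bar>t - s\<bar>"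
    by (rule time_estimate[OF ab(1,2)]) blast
  define l where "l = C * a powr (- 1 / r)"
  have l: "l \<ge> 0" using C by (simp add: l_def)
  \<comment> \<open>On a ball of radius \<open>t0 / 2\<close> all times stay between
    \<open>a\<close> and \<open>b\<close>. The factor \<open>CARD('m)\<close> comes from bounding
    the Euclidean norm by the sum of the components.\<close>
  have "(real CARD('m) * (l + L))-lipschitz_on (ball z0 (t0 / 2) \<inter> UNIV \<times> {0<..}) u"
  proof (rule lipschitz_onI)
    fix z z' assume z: "z \<in> ball z0 (t0 / 2) \<inter> UNIV \<times> {0<..}" "z' \<in> ball z0 (t0 / 2) \<inter> UNIV \<times> {0<..}"
    obtain x t y s where zz: "z = (x, t)" "z' = (y, s)" by (cases z, cases z')
    have ball: "a \<le> \<tau> \<and> \<tau> \<le> b" if "(v, \<tau>) \<in> ball z0 (t0 / 2)" for v \<tau>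
      using that dist_snd_le[of z0 "(v, \<tau>)"] z0 by (auto simp: a_def b_def dist_real_def)
    have t: "a \<le> t" "t \<le> b" "a \<le> s" "s \<le> b" using ball z zz by blast+
    have comp: "\<bar>(u z - u z') $ i\<bar> \<le> (l + L) * dist z z'" for i
    proof -
      have "t powr (- 1 / r) \<le> a powr (- 1 / r)" using t ab constants by (intro powr_mono2') auto
      then have "C * t powr (- 1 / r) * norm (x - y) \<le> l * norm (x - y)"
        unfolding l_def using C by (intro mult_right_mono mult_left_mono) auto
      then have "\<bar>u (x, t) $ i - u (y, t) $ i\<bar> \<le> l * norm (x - y)" using C(2)[of t x i y] t ab by simp
      moreover have "\<dots> \<le> l * dist z z'"
        using l dist_fst_le[of z z'] by (intro mult_left_mono) (auto simp: zz dist_norm)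
      moreover have "\<bar>u (y, t) $ i - u (y, s) $ i\<bar> \<le> L * \<bar>t - s\<bar>" using L(2) t by blast
      moreover have "\<dots> \<le> L * dist z z'"
        using L(1) dist_snd_le[of z z'] by (intro mult_left_mono) (auto simp: zz dist_real_def)
      ultimately show ?thesis by (simp add: zz distrib_right)
    qed
    have "dist (u z) (u z') \<le> (\<Sum>i\<in>UNIV. \<bar>(u z - u z') $ i\<bar>)"
      unfolding dist_norm by (rule norm_le_l1_cart)
    also have "\<dots> \<le> (\<Sum>i\<in>(UNIV::'m set). (l + L) * dist z z')" by (intro sum_mono comp)
    finally show "dist (u z) (u z') \<le> real CARD('m) * (l + L) * dist z z'" by (simp add: mult.assoc)
  qed (use l L in auto)
  then show "\<exists>\<epsilon>>0. \<exists>L. L-lipschitz_on (ball z0 \<epsilon> \<inter> UNIV \<times> {0<..}) u"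
    using z0 by (intro exI[of _ "t0 / 2"]) auto
qed

text \<open>The spatial constant depends on the time horizon, so the constants for integer horizons
  are majorised by one continuous \<open>D\<close>. The power of \<open>t\<close> is a separate
  factor, and \<open>D\<close> is bounded on [0, 1]; therefore 1 serves as the time threshold and
  the maximum of \<open>D\<close> there as the constant.\<close>

lemma lipschitz_constant_rate:
  "\<exists>\<kappa> :: real \<Rightarrow> real.
     continuous_on {0<..} \<kappa> \<and> (\<forall>t>0. \<kappa> t > 0) \<and>
     (\<forall>x y. \<forall>t>0. infnorm (u (x, t) - u (y, t)) \<le> \<kappa> t * torus_dist x y) \<and>
     (\<exists>t\<^sub>\<Theta>>0. \<exists>\<kappa>\<^sub>0>0. \<forall>t. 0 < t \<and> t \<le> t\<^sub>\<Theta> \<longrightarrow> \<kappa> t \<le> \<kappa>\<^sub>0 * t powr (- 1 / r))"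
proof -
  have "\<exists>C\<ge>0. \<forall>x y t i. 0 < t \<and> t \<le> real n \<longrightarrow>
      \<bar>u (y, t) $ i - u (x, t) $ i\<bar> \<le> C * t powr (- 1 / r) * norm (y - x)" for n
  proof (rule spatial_estimate[of "real n + 1"])
    fix C assume "C > 0" "\<And>x y t i. \<lbrakk>0 < t; t \<le> real n + 1\<rbrakk> \<Longrightarrow>
      \<bar>u (y, t) $ i - u (x, t) $ i\<bar> \<le> C * t powr (- 1 / r) * norm (y - x)"
    then show ?thesis by (intro exI[of _ C]) auto
  qed simp
  then obtain c where c: "\<And>n. c n \<ge> 0" "\<And>n x y t i. \<lbrakk>0 < t; t \<le> real n\<rbrakk> \<Longrightarrow>
      \<bar>u (y, t) $ i - u (x, t) $ i\<bar> \<le> c n * t powr (- 1 / r) * norm (y - x)"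
    by metis
  obtain D where D: "continuous_on UNIV D" "\<And>t. D t > 0" "\<And>t. t > 0 \<Longrightarrow> \<exists>n. t \<le> real n \<and> c n \<le> D t"
    by (rule continuous_majorant[of c]) (use c(1) in blast)+
  define \<kappa> where "\<kappa> t = D t * t powr (- 1 / r)" for t
  have \<kappa>_pos: "\<kappa> t > 0" if "t > 0" for t using D(2) that by (simp add: \<kappa>_def)
  have bound: "infnorm (u (x, t) - u (y, t)) \<le> \<kappa> t * torus_dist x y" if t: "t > 0" for x y t
  proof (rule infnorm_le_torus_dist[of "\<lambda>x. u (x, t)"])
    show "periodic (\<lambda>x. u (x, t))" using cylinder t by (simp add: continuous_on_cylinder_def)
    show "\<kappa> t > 0" using \<kappa>_pos t by simp
    obtain n where n: "t \<le> real n" "c n \<le> D t" using D(3)[OF t] by blast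
    show "\<bar>u (y, t) $ i - u (x, t) $ i\<bar> \<le> \<kappa> t * norm (y - x)" for x y i
    proof -
      have "c n * t powr (- 1 / r) * norm (y - x) \<le> \<kappa> t * norm (y - x)"
        unfolding \<kappa>_def using n by (intro mult_right_mono) auto
      then show ?thesis using c(2)[OF t n(1), of y i x] by linarith
    qed
  qed
  have "\<exists>s\<in>{0..1}. \<forall>t\<in>{0..1}. D t \<le> D s"
    by (rule continuous_attains_sup) (use D(1) in \<open>auto elim: continuous_on_subset\<close>)
  then obtain s where s: "\<And>t. \<lbrakk>0 \<le> t; t \<le> 1\<rbrakk> \<Longrightarrow> D t \<le> D s"
    by (meson atLeastAtMost_iff)
  have rate: "\<kappa> t \<le> D s * t powr (- 1 / r)" if "0 < t" "t \<le> 1" for t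
    unfolding \<kappa>_def using s that by (intro mult_right_mono) auto
  have "continuous_on {0<..} \<kappa>"
    unfolding \<kappa>_def using constants
    by (intro continuous_intros continuous_on_subset[OF D(1)]) auto
  moreover have "\<exists>t\<^sub>\<Theta>>0. \<exists>\<kappa>\<^sub>0>0. \<forall>t. 0 < t \<and> t \<le> t\<^sub>\<Theta> \<longrightarrow> \<kappa> t \<le> \<kappa>\<^sub>0 * t powr (- 1 / r)"
    using rate D(2)[of s] zero_less_one by blast
  ultimately show ?thesis using \<kappa>_pos bound by blast
qed

end

theorem theorem1p2:
  fixes H :: "'m::finite \<Rightarrow> real^'n \<Rightarrow> real^'n \<Rightarrow> real^'m \<Rightarrow> real"
    and h :: "'m \<Rightarrow> real^'n \<Rightarrow> real^'n \<Rightarrow> real"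
    and P :: "'m \<Rightarrow> real^'n \<Rightarrow> real^'m \<Rightarrow> real"
    and \<phi> :: "real^'n \<Rightarrow> real^'m"
    and u :: "(real^'n) \<times> real \<Rightarrow> real^'m"
    and \<Theta> r A :: real
  assumes "CARD('n) > 1" and "CARD('m) > 1"
    and H_periodic: "\<And>i p w. periodic (\<lambda>x. H i x p w)"
    and H_C2: "\<And>i. C2_on UNIV (\<lambda>(x, p, w). H i x p w)"
    and H1: "\<And>i x w. strictly_convex (\<lambda>p. H i x p w)"
    and H2: "\<And>i x w. filterlim (\<lambda>p. H i x p w / norm p) at_top at_infinity"
    and \<Theta>_pos: "\<Theta> > 0"
    and H3: "\<And>i x p v w. \<bar>H i x p v - H i x p w\<bar> \<le> \<Theta> * infnorm (v - w)"
    and h_periodic: "\<And>i p. periodic (\<lambda>x. h i x p)"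
    and P_periodic: "\<And>i w. periodic (\<lambda>x. P i x w)"
    and Hstar_split: "\<And>i x p w. H i x p w = h i x p + P i x w"
    and Hstar_consts: "r > 1" "A > 1"
    and Hstar_growth: "\<And>i x p. norm p powr r / A - A \<le> h i x p"
                      "\<And>i x p. h i x p \<le> A * norm p powr r"
    and Hstar_grad: "\<And>i x p. \<exists>g. GDERIV (\<lambda>y. h i y p) x :> g \<and> norm g \<le> A * (norm p powr r + 1)"
    and \<phi>_cont: "continuous_on UNIV \<phi>" and \<phi>_periodic: "periodic \<phi>"
    and u_solution: "viscosity_solution H \<phi> u"
  shows "locally_lipschitz_on (UNIV \<times> {0<..}) u \<and>
    (\<exists>\<kappa> :: real \<Rightarrow> real.
       continuous_on {0<..} \<kappa> \<and> (\<forall>t>0. \<kappa> t > 0) \<and>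
       (\<forall>x y. \<forall>t>0. infnorm (u (x, t) - u (y, t)) \<le> \<kappa> t * torus_dist x y) \<and>
       (\<exists>t\<^sub>\<Theta>>0. \<exists>\<kappa>\<^sub>0>0. \<forall>t. 0 < t \<and> t \<le> t\<^sub>\<Theta> \<longrightarrow> \<kappa> t \<le> \<kappa>\<^sub>0 * t powr (- 1 / r)))"
proof -
  interpret hamilton_jacobi_system H h P \<phi> u \<Theta> r A
    by (unfold_locales) (rule H_C2 H1 \<Theta>_pos H3 P_periodic Hstar_split Hstar_consts
        Hstar_growth Hstar_grad u_solution)+
  show ?thesis using solution_locally_lipschitz lipschitz_constant_rate by blast
qed

end
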